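(* Let $\mathcal{L}=\sum_n \mathsf{L}(n,\mathbf{u}_0,\dots,\mathbf{u}_J)$ be a functional whose Lagrangian $\mathsf{L}$ is invariant under the action of an $R$-dimensional Lie group $G$, let $\rho_k=\mathrm{S}_k\rho_0$ be a right difference moving frame with generating invariants $\boldsymbol{\kappa}$, write $\mathcal{L}=\sum_n L(n,\boldsymbol{\kappa}_0,\dots,\boldsymbol{\kappa}_{J_1})$ with $\boldsymbol{\kappa}_j=\mathrm{S}_j\boldsymbol{\kappa}$, and let the differential–difference syzygies be $\mathrm{d}\boldsymbol{\kappa}/\mathrm{d}t=\mathcal{H}\boldsymbol{\sigma}$, with $\sigma^\alpha=\rho_0\cdot(u_0^\alpha)'$ and $\mathcal{H}$ a matrix of linear difference operators whose coefficients are functions of $\boldsymbol{\kappa}$ and its shifts. Let $A_{\mathcal{H}}=\mathcal{C}^{j}_{\alpha}\,\mathrm{S}_j(\sigma^{\alpha})$ (summed over $j,\alpha$) be the boundary term, linear in the $\sigma^\alpha$ and their shifts, defined by $$\mathrm{E}_{\boldsymbol{\kappa}}(L)\cdot\mathcal{H}\boldsymbol{\sigma}-\big(\mathcal{H}^*\mathrm{E}_{\boldsymbol{\kappa}}(L)\big)\cdot\boldsymbol{\sigma}=(\mathrm{S}-\mathrm{id})A_{\mathcal{H}},$$ where each $\mathcal{C}^j_\alpha$ depends only on $n$, $\boldsymbol{\kappa}$ and its shifts. Let $\Phi^{\alpha}_0(I)=\Phi^{\alpha}(\rho_0\cdot\mathbf{u}_0)$ be the invariantization of the row of the matrix of characteristics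 corresponding to $u_0^\alpha$. Then the $R$ conservation laws (holding on all solutions of the invariantized Euler–Lagrange equations $\mathcal{H}^*\mathrm{E}_{\boldsymbol{\kappa}}(L)=0$) may be written in the form $$(\mathrm{S}-\mathrm{id})\{V(I)\,\mathcal{A}d(\rho_0)\}=0,$$ where $V(I)=(V_1\ \cdots\ V_R)$ is an invariant row vector. Specifically, $$V(I)=\mathcal{C}_{\alpha}^j\big(\mathrm{S}_j\Phi^{\alpha}_{0}(I)\big)\,\mathcal{A}d\big(\rho_j\rho_{0}^{-1}\big)\qquad(\text{summed over } j,\alpha).$$
   Context: Setting. The independent variable is $n\in\mathbb{Z}$; the dependent variables are $\mathbf{u}=(u^1,\dots,u^q)\in U\subset\mathbb{R}^q$, and $\mathbf{u}_j=\mathbf{u}(n+j)$. The shift operator is $\mathrm{S}:n\mapsto n+1$, $\mathrm{S}:u^\alpha_j\mapsto u^\alpha_{j+1}$, with powers $\mathrm{S}_j=\mathrm{S}^j$, $j\in\mathbb{Z}$; $\mathrm{id}$ is the identity operator. All calculations are formal, local and smooth. Repeated indices are summed. The prolongation space $P_n^{(J_0,J)}(U)$, $J_0\le0\le J$, over the fixed arbitrary base point $n$ is the product of $J-J_0+1$ copies of $U$ with coordinates $z=(\mathbf{u}_{J_0},\dots,\mathbf{u}_J)$; prolongation spaces are taken as large as needed. Group action and frame. A Lie group $G$ of dimension $R$ acts smoothly (left action) on $U$ and diagonally on prolongation spaces; the action on the relevant prolongation space (or a suitable domain of it) is free and regular. A right moving frame is a map $\rho_0$ from (a domain in) the prolongation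 space to $G$ with $\rho_0(g\cdot z)=\rho_0(z)g^{-1}$, determined by a cross-section $\mathcal{K}_0$ transverse to the orbits: $\rho_0(z)$ is the unique group element taking $z$ to $\mathcal{K}_0$. A difference moving frame is the sequence $\rho_k=\mathrm{S}_k\rho_0$. A set of invariants is generating if every difference invariant is a function of its elements and their shifts. A quantity is invariant if it is unchanged when $z$ is replaced by $g\cdot z$ for all $g\in G$. Variations. Let $\mathbf{u}=\mathbf{u}(t)$ depend smoothly on an auxiliary parameter $t$ (invariant under $G$), with $'=\mathrm{d}/\mathrm{d}t$; $\rho_0\cdot (u_0^\alpha)'=\big(\tfrac{\mathrm{d}}{\mathrm{d}t}(g\cdot u_0^\alpha)\big)\big|_{g=\rho_0}$ (group element held fixed while differentiating). Operators. $\mathrm{E}_{\kappa^\beta}(L)=\sum_j\mathrm{S}_{-j}\big(\partial L/\partial\kappa^\beta_j\big)$. The adjoint of $\mathcal{H}=\sum_j c_j\mathrm{S}_j$ is $\mathcal{H}^*(F)=\sum_j\mathrm{S}_{-j}(c_jF)$; for a matrix of operators, $(\mathcal{H}^* )_{\alpha\beta}=(\mathcal{H}_{\beta\alpha})^*$. Infinitesimals. Parametrize $G$ near the identity $e$ by $\mathbf{a}=(a^1,\dots,a^R)\mapsto\Gamma(\mathbf{a})$, $\Gamma(\mathbf{0})=e$. The infinitesimal generators are $\mathbf{v}_r=\xi^\alpha_r(\mathbf{u})\partial_{u^\alpha}$, $\xi_r^\alpha(\mathbf{u})=\partial(\Gamma(\mathbf{a})\cdot\mathbf{u})^\alpha/\partial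 a^r|_{\mathbf{a}=\mathbf{0}}$; they are taken to form a basis of the space of infinitesimal generators. The matrix of characteristics is the $q\times R$ matrix $\Phi(\mathbf{u})=(\xi_r^\alpha(\mathbf{u}))$, with rows $\Phi^\alpha$. For $g\in G$, with $\widetilde{\mathbf{u}}=g\cdot\mathbf{u}$ and $\widetilde{\mathbf{v}}_r=\xi_r^\alpha(\widetilde{\mathbf{u}})\partial_{\tilde u^\alpha}$, the $R\times R$ matrix $\mathcal{A}d(g)$ (adjoint representation) is defined by $(\mathbf{v}_1\ \cdots\ \mathbf{v}_R)=(\widetilde{\mathbf{v}}_1\ \cdots\ \widetilde{\mathbf{v}}_R)\,\mathcal{A}d(g)$. The $R$ conservation laws. For each $r$, let $\gamma_r(t)=\Gamma(0,\dots,0,t,0,\dots,0)$ ($t$ in position $r$). The $r$-th conservation law is the relation $(\mathrm{S}-\mathrm{id})A_{\mathcal{H}}=0$, holding on all solutions of $\mathcal{H}^*\mathrm{E}_{\boldsymbol{\kappa}}(L)=0$, in which the variation is along the group path $\gamma_r$, i.e. $\sigma^\alpha$ is evaluated as $\frac{\mathrm{d}}{\mathrm{d}t}\big|_{t=0}\big(g\cdot\gamma_r(t)\cdot u_0^\alpha\big)\big|_{g=\rho_0}$. The laws for $r=1,\dots,R$ are collected as a row vector. *)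

theory Defs
  imports "HOL-Analysis.Analysis" "HOL-Algebra.Group_Action"
begin

section \<open>Smooth maps\<close>

text \<open>Meant for open \<open>X\<close>. The directional derivatives along a basis determine the full derivative, so
  iterating them gives all orders of continuous differentiability.\<close>

primrec Ck_on :: "nat \<Rightarrow> 'a set \<Rightarrow> ('a::euclidean_space \<Rightarrow> 'b::real_normed_vector) \<Rightarrow> bool" where
  "Ck_on 0 X f \<longleftrightarrow> continuous_on X f"
| "Ck_on (Suc k) X f \<longleftrightarrow> (\<forall>x\<in>X. f differentiable (at x)) \<and>
     (\<forall>b\<in>Basis. Ck_on k X (\<lambda>x. frechet_derivative f (at x) b))"

definition smooth_on :: "'a set \<Rightarrow> ('a::euclidean_space \<Rightarrow> 'b::real_normed_vector) \<Rightarrow> bool" where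
  "smooth_on X f \<longleftrightarrow> (\<forall>k. Ck_on k X f)"

section \<open>Lie groups and smooth actions\<close>

text \<open>
  A chart of a manifold is a pair \<open>(V, x)\<close> of a coordinate domain \<open>V\<close> and a coordinate map
  \<open>x\<close>. \<open>smooth_into A X f\<close> says that \<open>f\<close>, defined on the open subset \<open>X\<close> of a Euclidean space and
  with values in the manifold with atlas \<open>A\<close>, is smooth; the openness of the preimages of the
  coordinate domains supplies the continuity of \<open>f\<close>.
\<close>

definition smooth_into ::
  "('g set \<times> ('g \<Rightarrow> 'c::euclidean_space)) set \<Rightarrow> 'a::euclidean_space set \<Rightarrow> ('a \<Rightarrow> 'g) \<Rightarrow> bool" where
  "smooth_into A X f \<longleftrightarrow>
     (\<forall>(W, y)\<in>A. open {a\<in>X. f a \<in> W} \<and> smooth_on {a\<in>X. f a \<in> W} (\<lambda>a. y (f a)))"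

text \<open>A Lie group of dimension \<open>CARD('r)\<close>; the atlas need not be maximal.\<close>

locale lie_group = group G
  for G :: "('g, 'm) monoid_scheme" (structure)
    and T :: "'g topology"
    and A :: "('g set \<times> ('g \<Rightarrow> real ^ 'r)) set" +
  assumes topspace: "topspace T = carrier G"
    and Hausdorff: "Hausdorff_space T"
    and second_countable: "second_countable T"
    and cover: "(\<Union>(V, x)\<in>A. V) = carrier G"
    and chart_open: "(V, x) \<in> A \<Longrightarrow> openin T V \<and> open (x ` V)"
    and chart_homeomorphic:
      "(V, x) \<in> A \<Longrightarrow> homeomorphic_map (subtopology T V) (top_of_set (x ` V)) x"
    and transition_smooth: "(V, x) \<in> A \<Longrightarrow> smooth_into A (x ` V) (inv_into V x)"
    and mult_smooth: "(V, x) \<in> A \<Longrightarrow> (W, y) \<in> A \<Longrightarrow>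
      smooth_into A ((x ` V) \<times> (y ` W)) (\<lambda>(a, b). inv_into V x a \<otimes> inv_into W y b)"
    and inv_smooth: "(V, x) \<in> A \<Longrightarrow> smooth_into A (x ` V) (\<lambda>a. inv (inv_into V x a))"

text \<open>
  For \<open>\<Gamma>\<close> a parametrization of \<open>G\<close> near the identity, \<open>characteristics \<phi> \<Gamma> u\<close> is the \<open>q \<times> R\<close> matrix of
  characteristics, with entry \<open>\<xi>\<^sup>\<alpha>\<^sub>r(u)\<close> in row \<open>\<alpha>\<close> and column \<open>r\<close>.
\<close>

definition characteristics ::
  "('g \<Rightarrow> real ^ 'q \<Rightarrow> real ^ 'q) \<Rightarrow> (real ^ 'r \<Rightarrow> 'g) \<Rightarrow> real ^ 'q \<Rightarrow> real ^ 'r ^ 'q" where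
  "characteristics \<phi> \<Gamma> u = (\<chi> \<alpha> r. deriv (\<lambda>t. \<phi> (\<Gamma> (axis r t)) u $ \<alpha>) 0)"

text \<open>
  A smooth left action on an open set \<open>U\<close>. The parametrization \<open>\<Gamma>\<close> is the inverse of a chart of
  the atlas: compatible coordinates can always be added to an atlas. The generators
  are linearly independent; that they span the space of infinitesimal generators
  is automatic.
\<close>

locale lie_group_action = lie_group G T A + group_action G U \<phi>
  for G :: "('g, 'm) monoid_scheme" (structure)
    and T :: "'g topology"
    and A :: "('g set \<times> ('g \<Rightarrow> real ^ 'r)) set"
    and U :: "(real ^ 'q) set"
    and \<phi> :: "'g \<Rightarrow> real ^ 'q \<Rightarrow> real ^ 'q"
    and N :: "(real ^ 'r) set"
    and \<Gamma> :: "real ^ 'r \<Rightarrow> 'g" +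
  assumes open_U: "open U"
    and action_smooth: "(V, x) \<in> A \<Longrightarrow> smooth_on ((x ` V) \<times> U) (\<lambda>(a, u). \<phi> (inv_into V x a) u)"
    and param_domain: "open N" "0 \<in> N" "inj_on \<Gamma> N"
    and param_chart: "(\<Gamma> ` N, inv_into N \<Gamma>) \<in> A"
    and param_0: "\<Gamma> 0 = \<one>"
    and generators_independent: "(\<forall>u\<in>U. characteristics \<phi> \<Gamma> u *v c = 0) \<Longrightarrow> c = 0"

text \<open>
  The defining relation of the adjoint representation, an equality of rows of vector fields, is
  written in components with respect to \<open>\<partial>/\<partial>\<tilde>u\<^sup>\<beta>\<close>, where \<open>\<tilde>u = g \<cdot> u\<close>: the component of
  \<open>v\<^sub>r = \<xi>\<^sup>\<alpha>\<^sub>r(u) \<partial>/\<partial>u\<^sup>\<alpha>\<close> is \<open>(\<partial>\<tilde>u\<^sup>\<beta>/\<partial>u\<^sup>\<alpha>) \<xi>\<^sup>\<alpha>\<^sub>r(u)\<close>, and that of \<open>\<tilde>v\<^sub>s\<close> is \<open>\<xi>\<^sup>\<beta>\<^sub>s(\<tilde>u)\<close>.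
\<close>

definition adjoint_rep ::
  "('g \<Rightarrow> real ^ 'q \<Rightarrow> real ^ 'q) \<Rightarrow> (real ^ 'r \<Rightarrow> 'g) \<Rightarrow> (real ^ 'q) set \<Rightarrow> 'g \<Rightarrow> real ^ 'r ^ 'r" where
  "adjoint_rep \<phi> \<Gamma> U g = (THE M. \<forall>u\<in>U.
     matrix (frechet_derivative (\<phi> g) (at u)) ** characteristics \<phi> \<Gamma> u
       = characteristics \<phi> \<Gamma> (\<phi> g u) ** M)"

section \<open>Functions on difference prolongation spaces\<close>

text \<open>
  A point over the base point \<open>n\<close> is a sequence \<open>z\<close> with \<open>z j\<close> the value of the dependent
  variables at \<open>n + j\<close>. The prolongation space of \<open>X\<close> with window \<open>{J\<^sub>0..J}\<close> is
  \<open>{J\<^sub>0..J} \<rightarrow>\<^sub>E X\<close>; a function of such windows is treated as a function of whole sequences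
  that depends only on the window.

  Quantities that may vary from base point to base point take \<open>n\<close> as first argument, and the shift
  operator \<open>S\<^sub>k\<close> acts on both arguments. The element type of the sequences is arbitrary, so that
  the same operator serves sequences of dependent variables, sequences of invariants, and
  sequences of curves \<open>t \<mapsto> u\<^sub>j(t)\<close>.
\<close>

definition shift :: "int \<Rightarrow> (int \<Rightarrow> (int \<Rightarrow> 'v) \<Rightarrow> 'b) \<Rightarrow> int \<Rightarrow> (int \<Rightarrow> 'v) \<Rightarrow> 'b" where
  "shift k F n z = F (n + k) (\<lambda>j. z (j + k))"

definition depends_on :: "int set \<Rightarrow> ((int \<Rightarrow> 'v) \<Rightarrow> 'b) \<Rightarrow> bool" where
  "depends_on I F \<longleftrightarrow> (\<forall>z. F z = F (restrict z I))"

definition pderiv_at ::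
  "int \<Rightarrow> 'v \<Rightarrow> ((int \<Rightarrow> 'v::real_normed_vector) \<Rightarrow> 'b::real_normed_vector) \<Rightarrow> (int \<Rightarrow> 'v) \<Rightarrow> 'b" where
  "pderiv_at j b F z = vector_derivative (\<lambda>s. F (z(j := z j + s *\<^sub>R b))) (at 0)"

primrec Ck_window ::
  "nat \<Rightarrow> int set \<Rightarrow> (int \<Rightarrow> 'v::euclidean_space) set \<Rightarrow>
     ((int \<Rightarrow> 'v) \<Rightarrow> 'b::real_normed_vector) \<Rightarrow> bool" where
  "Ck_window 0 I D F \<longleftrightarrow> continuous_on D F"
| "Ck_window (Suc k) I D F \<longleftrightarrow> continuous_on D F \<and>
     (\<forall>j\<in>I. \<forall>b\<in>Basis. (\<forall>z\<in>D. (\<lambda>s. F (z(j := z j + s *\<^sub>R b))) differentiable (at 0)) \<and>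
        Ck_window k I D (pderiv_at j b F))"

text \<open>Smoothness on a relatively open set \<open>D\<close> of windows over the index set \<open>I\<close>.\<close>

definition smooth_window ::
  "int set \<Rightarrow> (int \<Rightarrow> 'v::euclidean_space) set \<Rightarrow>
     ((int \<Rightarrow> 'v) \<Rightarrow> 'b::real_normed_vector) \<Rightarrow> bool" where
  "smooth_window I D F \<longleftrightarrow> (\<forall>k. Ck_window k I D F)"

text \<open>
  A function of \<open>n\<close> and of the entries in the window \<open>I\<close>, smooth on a neighbourhood
  of the windows of the sequences under consideration (\<open>Z n\<close> over the base point \<open>n\<close>).
\<close>

definition difference_function ::
  "int set \<Rightarrow> (int \<Rightarrow> (int \<Rightarrow> 'v::euclidean_space) set) \<Rightarrow>
     (int \<Rightarrow> (int \<Rightarrow> 'v) \<Rightarrow> 'b::real_normed_vector) \<Rightarrow> bool" where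
  "difference_function I Z F \<longleftrightarrow> (\<forall>n. depends_on I (F n) \<and>
     (\<exists>D. openin (top_of_set (I \<rightarrow>\<^sub>E UNIV)) D \<and> (\<lambda>z. restrict z I) ` Z n \<subseteq> D \<and>
        smooth_window I D (F n)))"

text \<open>The diagonal action; \<open>I = UNIV\<close> gives the action on whole sequences.\<close>

definition prolonged :: "int set \<Rightarrow> ('g \<Rightarrow> 'v \<Rightarrow> 'v) \<Rightarrow> 'g \<Rightarrow> (int \<Rightarrow> 'v) \<Rightarrow> int \<Rightarrow> 'v" where
  "prolonged I \<phi> g z = (\<lambda>j\<in>I. \<phi> g (z j))"

definition invariant_on ::
  "('g, 'm) monoid_scheme \<Rightarrow> ('g \<Rightarrow> 'v \<Rightarrow> 'v) \<Rightarrow> (int \<Rightarrow> (int \<Rightarrow> 'v) set) \<Rightarrow>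
     (int \<Rightarrow> (int \<Rightarrow> 'v) \<Rightarrow> 'b) \<Rightarrow> bool" where
  "invariant_on G \<phi> Z F \<longleftrightarrow>
     (\<forall>n. \<forall>z\<in>Z n. \<forall>g\<in>carrier G. F n (prolonged UNIV \<phi> g z) = F n z)"

definition difference_invariant ::
  "('g, 'm) monoid_scheme \<Rightarrow> ('g \<Rightarrow> 'v \<Rightarrow> 'v) \<Rightarrow> (int \<Rightarrow> (int \<Rightarrow> 'v::euclidean_space) set) \<Rightarrow>
     (int \<Rightarrow> (int \<Rightarrow> 'v) \<Rightarrow> 'b::real_normed_vector) \<Rightarrow> bool" where
  "difference_invariant G \<phi> Z F \<longleftrightarrow>
     (\<exists>a b. difference_function {a..b} Z F) \<and> invariant_on G \<phi> Z F"

text \<open>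
  \<open>invariant_jet \<kappa> n z\<close> is the sequence of the \<open>\<kappa>\<^sub>j = S\<^sub>j \<kappa>\<close>, and \<open>in_terms_of \<kappa> F\<close> is the function \<open>F\<close> of
  \<open>n\<close>, \<open>\<kappa>\<close> and its shifts, regarded as a function of the variables on which \<open>\<kappa>\<close> depends.
\<close>

definition invariant_jet ::
  "(int \<Rightarrow> (int \<Rightarrow> 'w) \<Rightarrow> 'c) \<Rightarrow> int \<Rightarrow> (int \<Rightarrow> 'w) \<Rightarrow> int \<Rightarrow> 'c" where
  "invariant_jet \<kappa> n z = (\<lambda>j. shift j \<kappa> n z)"

definition in_terms_of ::
  "(int \<Rightarrow> (int \<Rightarrow> 'w) \<Rightarrow> 'c) \<Rightarrow> (int \<Rightarrow> (int \<Rightarrow> 'c) \<Rightarrow> 'b) \<Rightarrow> int \<Rightarrow> (int \<Rightarrow> 'w) \<Rightarrow> 'b" where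
  "in_terms_of \<kappa> F n z = F n (invariant_jet \<kappa> n z)"

definition generating_invariants ::
  "('g, 'm) monoid_scheme \<Rightarrow> ('g \<Rightarrow> 'v \<Rightarrow> 'v) \<Rightarrow> (int \<Rightarrow> (int \<Rightarrow> 'v::euclidean_space) set) \<Rightarrow>
     (int \<Rightarrow> (int \<Rightarrow> 'v) \<Rightarrow> real ^ 'k) \<Rightarrow> bool" where
  "generating_invariants G \<phi> Z \<kappa> \<longleftrightarrow> difference_invariant G \<phi> Z \<kappa> \<and>
     (\<forall>F :: int \<Rightarrow> (int \<Rightarrow> 'v) \<Rightarrow> real. difference_invariant G \<phi> Z F \<longrightarrow>
        (\<exists>f a b. (\<forall>n. depends_on {a..b} (f n)) \<and> (\<forall>n. \<forall>z\<in>Z n. F n z = in_terms_of \<kappa> f n z)))"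

section \<open>Difference moving frames\<close>

text \<open>
  Regularity: every point has arbitrarily small neighbourhoods that meet each orbit in a
  path-connected set. (For a free action all orbits have the dimension of \<open>G\<close>.)
\<close>

definition regular_on ::
  "('g, 'm) monoid_scheme \<Rightarrow> ('g \<Rightarrow> 'z \<Rightarrow> 'z) \<Rightarrow> 'z::topological_space set \<Rightarrow> bool" where
  "regular_on G \<psi> M \<longleftrightarrow> (\<forall>z\<in>M. \<forall>B. openin (top_of_set M) B \<and> z \<in> B \<longrightarrow>
     (\<exists>B'\<subseteq>B. openin (top_of_set M) B' \<and> z \<in> B' \<and>
        (\<forall>w\<in>M. path_connected (orbit G \<psi> w \<inter> B'))))"

text \<open>
  A cross-section is locally the common zero set of \<open>R\<close> functions \<open>f\<^sub>i\<close>; it is a submanifold of codimension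
  \<open>R\<close> transverse to the orbits since the matrix \<open>(v\<^sub>r f\<^sub>i)\<close>, with \<open>v\<^sub>r\<close> the prolonged generators, is
  nonsingular.
\<close>

definition cross_section ::
  "int set \<Rightarrow> ('g \<Rightarrow> 'v \<Rightarrow> 'v) \<Rightarrow> (real ^ 'r \<Rightarrow> 'g) \<Rightarrow> (int \<Rightarrow> 'v::euclidean_space) set \<Rightarrow>
     (int \<Rightarrow> 'v) set \<Rightarrow> bool" where
  "cross_section I \<phi> \<Gamma> M K \<longleftrightarrow> K \<subseteq> M \<and>
     (\<forall>z\<in>K. \<exists>B (f :: (int \<Rightarrow> 'v) \<Rightarrow> real ^ 'r).
        openin (top_of_set M) B \<and> z \<in> B \<and> smooth_window I B f \<and> K \<inter> B = {w\<in>B. f w = 0} \<and>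
        det (\<chi> i r. deriv (\<lambda>t. f (prolonged I \<phi> (\<Gamma> (axis r t)) z) $ i) 0) \<noteq> 0)"

text \<open>
  The frame \<open>\<rho>\<close> (that is, \<open>\<rho>\<^sub>0\<close>) is defined on an invariant domain \<open>M n\<close> of the prolongation space over
  \<open>n\<close> by a cross-section \<open>K n\<close>. The difference moving frame is the sequence of its shifts
  \<open>\<rho>\<^sub>k = shift k \<rho>\<close>.
\<close>

locale difference_moving_frame = lie_group_action G T A U \<phi> N \<Gamma>
  for G :: "('g, 'm) monoid_scheme" (structure)
    and T :: "'g topology"
    and A :: "('g set \<times> ('g \<Rightarrow> real ^ 'r)) set"
    and U :: "(real ^ 'q) set"
    and \<phi> :: "'g \<Rightarrow> real ^ 'q \<Rightarrow> real ^ 'q"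
    and N :: "(real ^ 'r) set"
    and \<Gamma> :: "real ^ 'r \<Rightarrow> 'g"
    and J\<^sub>0 J :: int
    and M K :: "int \<Rightarrow> (int \<Rightarrow> real ^ 'q) set"
    and \<rho> :: "int \<Rightarrow> (int \<Rightarrow> real ^ 'q) \<Rightarrow> 'g" +
  assumes window: "J\<^sub>0 \<le> 0" "0 \<le> J"
    and domain_open: "openin (top_of_set ({J\<^sub>0..J} \<rightarrow>\<^sub>E U)) (M n)"
    and domain_invariant: "z \<in> M n \<Longrightarrow> g \<in> carrier G \<Longrightarrow> prolonged {J\<^sub>0..J} \<phi> g z \<in> M n"
    and free: "z \<in> M n \<Longrightarrow> stabilizer G (prolonged {J\<^sub>0..J} \<phi>) z = {\<one>}"
    and regular: "regular_on G (prolonged {J\<^sub>0..J} \<phi>) (M n)"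
    and cross_section: "cross_section {J\<^sub>0..J} \<phi> \<Gamma> (M n) (K n)"
    and frame_window: "depends_on {J\<^sub>0..J} (\<rho> n)"
    and frame_carrier: "z \<in> M n \<Longrightarrow> \<rho> n z \<in> carrier G"
    and frame_smooth: "(V, x) \<in> A \<Longrightarrow>
      openin (top_of_set (M n)) {z\<in>M n. \<rho> n z \<in> V} \<and>
      smooth_window {J\<^sub>0..J} {z\<in>M n. \<rho> n z \<in> V} (\<lambda>z. x (\<rho> n z))"
    and frame_cross_section: "z \<in> M n \<Longrightarrow> g \<in> carrier G \<Longrightarrow>
      prolonged {J\<^sub>0..J} \<phi> g z \<in> K n \<longleftrightarrow> g = \<rho> n z"
    and frame_equivariant: "z \<in> M n \<Longrightarrow> g \<in> carrier G \<Longrightarrow>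
      \<rho> n (prolonged {J\<^sub>0..J} \<phi> g z) = \<rho> n z \<otimes> inv g"

text \<open>The sequences at which all \<open>\<rho>\<^sub>k\<close> are defined.\<close>

definition frame_domain ::
  "int \<Rightarrow> int \<Rightarrow> (int \<Rightarrow> (int \<Rightarrow> 'v) set) \<Rightarrow> int \<Rightarrow> (int \<Rightarrow> 'v) set" where
  "frame_domain J\<^sub>0 J M n = {z. \<forall>k. (\<lambda>j\<in>{J\<^sub>0..J}. z (j + k)) \<in> M (n + k)}"

section \<open>Variations\<close>

text \<open>
  A variation is a sequence \<open>v\<close> of curves, \<open>v j t\<close> being \<open>u\<^sub>j(t)\<close>, smooth near the parameter value \<open>t\<close>.
  A function \<open>F\<close> is evaluated along it by \<open>at_time t F\<close>, which still is a function of a base point and a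
  sequence (of curves), so that \<open>shift\<close> applies.
\<close>

definition variation ::
  "(int \<Rightarrow> 'v::real_normed_vector) set \<Rightarrow> real \<Rightarrow> (int \<Rightarrow> real \<Rightarrow> 'v) \<Rightarrow> bool" where
  "variation Z t v \<longleftrightarrow>
     (\<exists>X. open X \<and> t \<in> X \<and> (\<forall>j. smooth_on X (v j)) \<and> (\<forall>s\<in>X. (\<lambda>j. v j s) \<in> Z))"

definition at_time ::
  "real \<Rightarrow> (int \<Rightarrow> (int \<Rightarrow> 'v) \<Rightarrow> 'b) \<Rightarrow> int \<Rightarrow> (int \<Rightarrow> real \<Rightarrow> 'v) \<Rightarrow> 'b" where
  "at_time t F n v = F n (\<lambda>j. v j t)"

text \<open>\<open>\<sigma>\<^sup>\<alpha> = \<rho>\<^sub>0 \<cdot> (u\<^sub>0\<^sup>\<alpha>)'\<close> at time \<open>t\<close>; the frame is held fixed during the differentiation.\<close>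

definition frame_sigma ::
  "('g \<Rightarrow> real ^ 'q \<Rightarrow> real ^ 'q) \<Rightarrow> (int \<Rightarrow> (int \<Rightarrow> real ^ 'q) \<Rightarrow> 'g) \<Rightarrow> real \<Rightarrow>
     int \<Rightarrow> (int \<Rightarrow> real \<Rightarrow> real ^ 'q) \<Rightarrow> real ^ 'q" where
  "frame_sigma \<phi> \<rho> t n v = (\<chi> \<alpha>. deriv (\<lambda>s. \<phi> (at_time t \<rho> n v) (v 0 s) $ \<alpha>) t)"

text \<open>\<open>\<sigma>\<^sup>\<alpha>\<close> for the variation along the group path \<open>\<gamma>\<^sub>r(t) = \<Gamma>(0, \<dots>, t, \<dots>, 0)\<close>, at \<open>t = 0\<close>.\<close>

definition sigma_path ::
  "('g \<Rightarrow> real ^ 'q \<Rightarrow> real ^ 'q) \<Rightarrow> (real ^ 'r \<Rightarrow> 'g) \<Rightarrow> (int \<Rightarrow> (int \<Rightarrow> real ^ 'q) \<Rightarrow> 'g) \<Rightarrow> 'r \<Rightarrow>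
     int \<Rightarrow> (int \<Rightarrow> real ^ 'q) \<Rightarrow> real ^ 'q" where
  "sigma_path \<phi> \<Gamma> \<rho> r n z = (\<chi> \<alpha>. deriv (\<lambda>t. \<phi> (\<rho> n z) (\<phi> (\<Gamma> (axis r t)) (z 0)) $ \<alpha>) 0)"

section \<open>Difference operators and the boundary term\<close>

text \<open>
  In the following operators, \<open>\<kappa>\<close> and \<open>\<sigma>\<close> are functions of a base point and a sequence of any kind.
  The coefficients of \<open>H\<close> are functions \<open>h j \<beta> \<alpha>\<close> of \<open>\<kappa>\<close> and its shifts, where \<open>j\<close> runs over the finite
  set \<open>I\<close>: the entry of \<open>H\<close> in row \<open>\<beta>\<close> and column \<open>\<alpha>\<close> is the sum of the \<open>h j \<beta> \<alpha> S\<^sub>j\<close>.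
\<close>

definition diff_op ::
  "int set \<Rightarrow> (int \<Rightarrow> 'k \<Rightarrow> 'q \<Rightarrow> (int \<Rightarrow> real ^ 'k) \<Rightarrow> real) \<Rightarrow>
     (int \<Rightarrow> (int \<Rightarrow> 'w) \<Rightarrow> real ^ 'k) \<Rightarrow> (int \<Rightarrow> (int \<Rightarrow> 'w) \<Rightarrow> real ^ 'q) \<Rightarrow>
     int \<Rightarrow> (int \<Rightarrow> 'w) \<Rightarrow> real ^ 'k" where
  "diff_op I h \<kappa> \<sigma> n w =
     (\<chi> \<beta>. \<Sum>\<alpha>\<in>UNIV. \<Sum>j\<in>I. in_terms_of \<kappa> (\<lambda>_. h j \<beta> \<alpha>) n w * shift j \<sigma> n w $ \<alpha>)"

text \<open>\<open>adjoint_op I h \<kappa> E\<close> is \<open>H\<^sup>*\<close> applied to \<open>E\<close>.\<close>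

definition adjoint_op ::
  "int set \<Rightarrow> (int \<Rightarrow> 'k \<Rightarrow> 'q \<Rightarrow> (int \<Rightarrow> real ^ 'k) \<Rightarrow> real) \<Rightarrow>
     (int \<Rightarrow> (int \<Rightarrow> 'w) \<Rightarrow> real ^ 'k) \<Rightarrow> (int \<Rightarrow> (int \<Rightarrow> 'w) \<Rightarrow> real ^ 'k) \<Rightarrow>
     int \<Rightarrow> (int \<Rightarrow> 'w) \<Rightarrow> real ^ 'q" where
  "adjoint_op I h \<kappa> E n w = (\<chi> \<alpha>. \<Sum>\<beta>\<in>UNIV. \<Sum>j\<in>I.
     shift (-j) (\<lambda>m x. in_terms_of \<kappa> (\<lambda>_. h j \<beta> \<alpha>) m x * E m x $ \<beta>) n w)"

text \<open>
  The Euler operator, for a Lagrangian depending on \<open>\<kappa>\<^sub>0, \<dots>, \<kappa>\<^bsub>J\<^esub>\<close>. Its value is a function of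
  \<open>n\<close>, \<open>\<kappa>\<close> and its shifts.
\<close>

definition euler ::
  "int \<Rightarrow> (int \<Rightarrow> (int \<Rightarrow> real ^ 'k) \<Rightarrow> real) \<Rightarrow> int \<Rightarrow> (int \<Rightarrow> real ^ 'k) \<Rightarrow> real ^ 'k" where
  "euler J L n k = (\<chi> \<beta>. \<Sum>j\<in>{0..J}. shift (-j) (\<lambda>m. pderiv_at j (axis \<beta> 1) (L m)) n k)"

text \<open>The boundary term with coefficients \<open>C j \<alpha>\<close>, which are functions of \<open>n\<close>, \<open>\<kappa>\<close> and its shifts.\<close>

definition boundary_term ::
  "int set \<Rightarrow> (int \<Rightarrow> 'q \<Rightarrow> int \<Rightarrow> (int \<Rightarrow> real ^ 'k) \<Rightarrow> real) \<Rightarrow>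
     (int \<Rightarrow> (int \<Rightarrow> 'w) \<Rightarrow> real ^ 'k) \<Rightarrow> (int \<Rightarrow> (int \<Rightarrow> 'w) \<Rightarrow> real ^ 'q) \<Rightarrow>
     int \<Rightarrow> (int \<Rightarrow> 'w) \<Rightarrow> real" where
  "boundary_term I C \<kappa> \<sigma> n w =
     (\<Sum>j\<in>I. \<Sum>\<alpha>\<in>UNIV. in_terms_of \<kappa> (C j \<alpha>) n w * shift j \<sigma> n w $ \<alpha>)"

section \<open>Conservation laws\<close>

text \<open>The invariantization \<open>\<Phi>\<^sub>0\<^sup>\<alpha>(I)\<close> of the row \<open>\<alpha>\<close> of the matrix of characteristics.\<close>

definition invariantized_row ::
  "('g \<Rightarrow> real ^ 'q \<Rightarrow> real ^ 'q) \<Rightarrow> (real ^ 'r \<Rightarrow> 'g) \<Rightarrow> (int \<Rightarrow> (int \<Rightarrow> real ^ 'q) \<Rightarrow> 'g) \<Rightarrow> 'q \<Rightarrow>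
     int \<Rightarrow> (int \<Rightarrow> real ^ 'q) \<Rightarrow> real ^ 'r" where
  "invariantized_row \<phi> \<Gamma> \<rho> \<alpha> n z = characteristics \<phi> \<Gamma> (\<phi> (\<rho> n z) (z 0)) $ \<alpha>"

definition noether_vector ::
  "('g, 'm) monoid_scheme \<Rightarrow> (real ^ 'q) set \<Rightarrow> ('g \<Rightarrow> real ^ 'q \<Rightarrow> real ^ 'q) \<Rightarrow>
     (real ^ 'r \<Rightarrow> 'g) \<Rightarrow> (int \<Rightarrow> (int \<Rightarrow> real ^ 'q) \<Rightarrow> 'g) \<Rightarrow>
     (int \<Rightarrow> (int \<Rightarrow> real ^ 'q) \<Rightarrow> real ^ 'k) \<Rightarrow> int set \<Rightarrow>
     (int \<Rightarrow> 'q \<Rightarrow> int \<Rightarrow> (int \<Rightarrow> real ^ 'k) \<Rightarrow> real) \<Rightarrow>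
     int \<Rightarrow> (int \<Rightarrow> real ^ 'q) \<Rightarrow> real ^ 'r" where
  "noether_vector G U \<phi> \<Gamma> \<rho> \<kappa> I C n z =
     (\<Sum>j\<in>I. \<Sum>\<alpha>\<in>UNIV. in_terms_of \<kappa> (C j \<alpha>) n z *\<^sub>R
        (shift j (invariantized_row \<phi> \<Gamma> \<rho> \<alpha>) n z v*
           adjoint_rep \<phi> \<Gamma> U (shift j \<rho> n z \<otimes>\<^bsub>G\<^esub> inv\<^bsub>G\<^esub> (\<rho> n z))))"

text \<open>The prolongation over \<open>n\<close> of a map \<open>u\<close> on the integers, and the solutions of a system \<open>E = 0\<close>.\<close>

definition jet :: "(int \<Rightarrow> 'v) \<Rightarrow> int \<Rightarrow> int \<Rightarrow> 'v" where
  "jet u n = (\<lambda>j. u (n + j))"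

definition solution ::
  "(int \<Rightarrow> (int \<Rightarrow> 'v) set) \<Rightarrow> (int \<Rightarrow> (int \<Rightarrow> 'v) \<Rightarrow> 'b::zero) \<Rightarrow> (int \<Rightarrow> 'v) \<Rightarrow> bool" where
  "solution Z E u \<longleftrightarrow> (\<forall>n. jet u n \<in> Z n \<and> E n (jet u n) = 0)"

end

theory Submission
  imports Defs
begin

text \<open>
  Along the group path in direction \<open>r\<close> the quantity \<open>\<sigma>\<^sup>\<alpha>\<close> is a first derivative of the action, hence an entry
  of \<open>(\<partial>(g \<cdot> u)/\<partial>u) \<Phi>(u)\<close> at \<open>g = \<rho>\<^sub>0\<close> and \<open>u = u\<^sub>0\<close>. By the defining property of the adjoint representation this
  matrix is \<open>\<Phi>(\<rho>\<^sub>0 \<cdot> u\<^sub>0) \<A>d(\<rho>\<^sub>0)\<close> (\<open>sigma_path_adjoint\<close>). Since \<open>\<A>d\<close> is multiplicative (\<open>adjoint_rep_mult\<close>),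
  the shift \<open>S\<^sub>j\<close> of this identity has the right factor
  \<open>\<A>d(\<rho>\<^sub>j) = \<A>d(\<rho>\<^sub>j \<rho>\<^sub>0\<^sup>-\<^sup>1) \<A>d(\<rho>\<^sub>0)\<close>, and the boundary term becomes
  \<open>V(I) \<A>d(\<rho>\<^sub>0)\<close> (\<open>boundary_term_sigma_path\<close>). The vector \<open>V(I)\<close> is built from the
  invariants \<open>\<kappa>\<close> and from shifts of \<open>\<rho>\<^sub>0 \<cdot> u\<^sub>0\<close> and the products \<open>\<rho>\<^sub>j \<rho>\<^sub>0\<^sup>-\<^sup>1\<close>, which are invariant by
  equivariance of the frame (\<open>noether_vector_invariant\<close>).

  The boundary term is conserved by Noether's argument (\<open>boundary_term_conserved\<close>): moving a solution
  along a group path is a variation under which \<open>\<kappa>\<close> is constant, so that \<open>H \<sigma> = d\<kappa>/dt = 0\<close>, while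
  \<open>H\<^sup>*\<close> of the Euler expression vanishes on solutions. Both terms on the left of the identity that
  defines the boundary term are then zero.

  The analytic point is that the matrix \<open>\<A>d(g)\<close> exists (\<open>adjoint_exists\<close>). In place of Lie
  brackets and the Lie algebra, its columns are obtained as the velocities at \<open>t = 0\<close> of the conjugated
  curves \<open>g \<Gamma>(0, \<dots>, t, \<dots>, 0) g\<^sup>-\<^sup>1\<close> in the coordinates of the parametrization, which takes only first
  derivatives of the group multiplication and of the action.
\<close>

section \<open>Calculus with charts\<close>

lemma smooth_on_imp_differentiable:
  assumes "smooth_on X f" and "x \<in> X"
  shows "f differentiable (at x)"
proof -
  have "Ck_on (Suc 0) X f"
    using assms(1) unfolding smooth_on_def by blast
  then show ?thesis
    using assms(2) by simp
qed

lemma Ck_on_cong: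
  assumes "open X" and "\<And>x. x \<in> X \<Longrightarrow> f x = g x" and "Ck_on k X f"
  shows "Ck_on k X g"
  using assms(2,3)
proof (induction k arbitrary: f g)
  case 0
  then show ?case
    by (simp cong: continuous_on_cong)
next
  case (Suc k)
  have diff: "(g has_derivative frechet_derivative f (at x)) (at x)" if "x \<in> X" for x
  proof -
    have "(f has_derivative frechet_derivative f (at x)) (at x)"
      using Suc.prems(2) that frechet_derivative_works by auto
    from has_derivative_transform_within_open[OF this assms(1) that Suc.prems(1)] show ?thesis .
  qed
  then have eq: "frechet_derivative g (at x) = frechet_derivative f (at x)" if "x \<in> X" for x
    using frechet_derivative_at that by metis
  have "Ck_on k X (\<lambda>x. frechet_derivative g (at x) b)" if "b \<in> Basis" for b
    using Suc.IH[of "\<lambda>x. frechet_derivative f (at x) b" "\<lambda>x. frechet_derivative g (at x) b"]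
      Suc.prems(2) that eq by simp
  then show ?case
    using diff by (auto simp: differentiable_def)
qed

text \<open>
  This makes the group paths smooth curves. Restricting to a line in the direction of a basis
  vector \<open>e\<close> turns the directional derivative along \<open>e\<close> into the ordinary derivative, so the recursive clauses for the two functions match and no
  higher order chain rule is called for.
\<close>

lemma Ck_on_line:
  assumes "open X" and "e \<in> Basis" and "\<And>t. t \<in> X \<Longrightarrow> p + t *\<^sub>R e \<in> Y" and "Ck_on k Y F"
  shows "Ck_on k X (\<lambda>t::real. F (p + t *\<^sub>R e))"
  using assms(4)
proof (induction k arbitrary: F)
  case 0
  then show ?case
    using assms(3)
    by (auto intro!: continuous_intros continuous_on_compose2[of Y F])
next
  case (Suc k)
  have der: "((\<lambda>t. F (p + t *\<^sub>R e)) has_derivative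
      (\<lambda>s. frechet_derivative F (at (p + t *\<^sub>R e)) (s *\<^sub>R e))) (at t)" if "t \<in> X" for t
  proof -
    have F: "(F has_derivative frechet_derivative F (at (p + t *\<^sub>R e))) (at (p + t *\<^sub>R e))"
      using Suc.prems assms(3)[OF that] frechet_derivative_works by auto
    have "((\<lambda>t. p + t *\<^sub>R e) has_derivative (\<lambda>s. s *\<^sub>R e)) (at t)"
      by (auto intro!: derivative_eq_intros)
    from has_derivative_compose[OF this F] show ?thesis .
  qed
  have "Ck_on k X (\<lambda>t. frechet_derivative F (at (p + t *\<^sub>R e)) e)"
    using Suc.IH[of "\<lambda>x. frechet_derivative F (at x) e"] Suc.prems assms(2) by simp
  moreover have "frechet_derivative F (at (p + t *\<^sub>R e)) e
      = frechet_derivative (\<lambda>t. F (p + t *\<^sub>R e)) (at t) 1" if "t \<in> X" for t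
    using frechet_derivative_at[OF der[OF that]] by (metis scaleR_one)
  ultimately have "Ck_on k X (\<lambda>t. frechet_derivative (\<lambda>t. F (p + t *\<^sub>R e)) (at t) 1)"
    by (rule Ck_on_cong[OF assms(1), rotated])
  then show ?case
    using der by (auto simp: differentiable_def Basis_real_def)
qed

lemma smooth_on_line:
  assumes "open X" and "e \<in> Basis" and "\<And>t. t \<in> X \<Longrightarrow> p + t *\<^sub>R e \<in> Y" and "smooth_on Y F"
  shows "smooth_on X (\<lambda>t::real. F (p + t *\<^sub>R e))"
  using Ck_on_line[OF assms(1-3)] assms(4) unfolding smooth_on_def by blast

lemma smooth_on_cong:
  assumes "open X" and "\<And>x. x \<in> X \<Longrightarrow> f x = g x" and "smooth_on X f"
  shows "smooth_on X g"
  using assms(3) Ck_on_cong[OF assms(1), of f g] assms(2) unfolding smooth_on_def by blast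

lemma has_derivative_transform_nhds:
  assumes "(f has_derivative D) (at x)" and "\<forall>\<^sub>F y in nhds x. f y = g y"
  shows "(g has_derivative D) (at x)"
proof (rule has_derivative_transform_eventually[OF assms(1)])
  show "\<forall>\<^sub>F y in at x. f y = g y" "f x = g x"
    using assms(2) eventually_nhds_x_imp_x by (auto simp: eventually_nhds_conv_at)
qed simp

lemma axis_eq_scaleR: "axis i t = t *\<^sub>R (axis i 1 :: real ^ 'n)"
  by (simp add: axis_def vec_eq_iff)

lemma axis_0: "axis i 0 = (0 :: real ^ 'n)"
  by (simp add: axis_def vec_eq_iff)

lemma matrix_eq_axis:
  fixes B B' :: "real ^ 'n ^ 'm"
  assumes "\<And>r. B *v axis r 1 = B' *v axis r 1"
  shows "B = B'"
proof -
  have "B $ i $ r = B' $ i $ r" for i r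
  proof -
    have "column r B $ i = column r B' $ i"
      using assms[of r] unfolding matrix_vector_mult_basis by (rule arg_cong)
    then show ?thesis
      by (simp add: column_def)
  qed
  then show ?thesis
    by (simp add: vec_eq_iff)
qed

lemma axis_has_derivative: "((axis i :: real \<Rightarrow> real ^ 'n) has_derivative axis i) (at t)"
proof -
  have "(axis i :: real \<Rightarrow> real ^ 'n) = (\<lambda>t. t *\<^sub>R axis i 1)"
    by (rule ext) (rule axis_eq_scaleR)
  then have "bounded_linear (axis i :: real \<Rightarrow> real ^ 'n)"
    using bounded_linear_scaleR_left by metis
  then show ?thesis
    by (rule bounded_linear_imp_has_derivative)
qed

lemma deriv_component:
  fixes f :: "real \<Rightarrow> real ^ 'n"
  assumes "(f has_derivative D) (at t)"
  shows "deriv (\<lambda>s. f s $ i) t = D 1 $ i"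
proof -
  have "((\<lambda>s. f s $ i) has_derivative (\<lambda>s. D s $ i)) (at t)"
    using bounded_linear.has_derivative[OF bounded_linear_vec_nth assms] .
  moreover have "D s $ i = (D 1 $ i) * s" for s
  proof -
    have "D (s *\<^sub>R 1) = s *\<^sub>R D 1"
      using linear_cmul[OF has_derivative_linear[OF assms]] .
    then show ?thesis
      by simp
  qed
  then have "(\<lambda>s. D s $ i) = (*) (D 1 $ i)"
    by (rule ext)
  ultimately have "((\<lambda>s. f s $ i) has_field_derivative D 1 $ i) (at t)"
    unfolding has_field_derivative_def by simp
  then show ?thesis
    by (rule DERIV_imp_deriv)
qed

context lie_group
begin

text \<open>
  Asking for one chart around the value is no weaker than asking for all of them: multiplying by the
  identity, which is smooth, passes to any other chart.
\<close>

definition chart_differentiable :: "('e::real_normed_vector \<Rightarrow> 'g) \<Rightarrow> 'e \<Rightarrow> bool" where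
  "chart_differentiable f a \<longleftrightarrow> (\<exists>(V, x)\<in>A. (\<forall>\<^sub>F b in nhds a. f b \<in> V) \<and>
     (\<lambda>b. x (f b)) differentiable (at a))"

lemma chart_subset: "(V, x) \<in> A \<Longrightarrow> V \<subseteq> carrier G"
  using cover by blast

lemma chart_inverse:
  assumes "(V, x) \<in> A" and "g \<in> V"
  shows "inv_into V x (x g) = g"
proof -
  have "inj_on x (topspace (subtopology T V))"
    by (rule homeomorphic_imp_injective_map[OF chart_homeomorphic[OF assms(1)]])
  moreover have "topspace (subtopology T V) = V"
    using chart_subset[OF assms(1)] topspace by (simp add: inf_absorb2)
  ultimately show ?thesis
    using assms(2) by simp
qed

lemma chart_around:
  assumes "g \<in> carrier G"
  obtains V x where "(V, x) \<in> A" and "g \<in> V"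
  using assms cover by blast

lemma chart_differentiable_const:
  assumes "g \<in> carrier G"
  shows "chart_differentiable (\<lambda>_. g) a"
  using assms unfolding chart_differentiable_def
  by (rule chart_around) (auto intro!: bexI)

text \<open>
  The chart in which the product is read off is arbitrary, so that a curve through the identity can be
  read in the coordinates of the given parametrization, although the intermediate
  products lie in other charts.
\<close>

lemma chart_differentiable_mult_in_chart:
  assumes f\<^sub>1: "chart_differentiable f\<^sub>1 a" and f\<^sub>2: "chart_differentiable f\<^sub>2 a"
    and W: "(W, y) \<in> A" "f\<^sub>1 a \<otimes> f\<^sub>2 a \<in> W"
  shows "(\<forall>\<^sub>F b in nhds a. f\<^sub>1 b \<otimes> f\<^sub>2 b \<in> W) \<and> (\<lambda>b. y (f\<^sub>1 b \<otimes> f\<^sub>2 b)) differentiable (at a)"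
proof -
  obtain V\<^sub>1 x\<^sub>1 where V\<^sub>1: "(V\<^sub>1, x\<^sub>1) \<in> A" "\<forall>\<^sub>F b in nhds a. f\<^sub>1 b \<in> V\<^sub>1"
      "(\<lambda>b. x\<^sub>1 (f\<^sub>1 b)) differentiable (at a)"
    using f\<^sub>1 unfolding chart_differentiable_def by blast
  obtain V\<^sub>2 x\<^sub>2 where V\<^sub>2: "(V\<^sub>2, x\<^sub>2) \<in> A" "\<forall>\<^sub>F b in nhds a. f\<^sub>2 b \<in> V\<^sub>2"
      "(\<lambda>b. x\<^sub>2 (f\<^sub>2 b)) differentiable (at a)"
    using f\<^sub>2 unfolding chart_differentiable_def by blast
  define \<mu> where "\<mu> = (\<lambda>(c, d). inv_into V\<^sub>1 x\<^sub>1 c \<otimes> inv_into V\<^sub>2 x\<^sub>2 d)"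
  define P where "P = {p \<in> (x\<^sub>1 ` V\<^sub>1) \<times> (x\<^sub>2 ` V\<^sub>2). \<mu> p \<in> W}"
  define f where "f b = (x\<^sub>1 (f\<^sub>1 b), x\<^sub>2 (f\<^sub>2 b))" for b
  have P: "open P" "smooth_on P (\<lambda>p. y (\<mu> p))"
    using mult_smooth[OF V\<^sub>1(1) V\<^sub>2(1)] W(1) unfolding smooth_into_def P_def \<mu>_def by auto
  have \<mu>: "\<mu> (f b) = f\<^sub>1 b \<otimes> f\<^sub>2 b" if "f\<^sub>1 b \<in> V\<^sub>1" "f\<^sub>2 b \<in> V\<^sub>2" for b
    using chart_inverse V\<^sub>1(1) V\<^sub>2(1) that by (simp add: \<mu>_def f_def)
  have ev: "\<forall>\<^sub>F b in nhds a. \<mu> (f b) = f\<^sub>1 b \<otimes> f\<^sub>2 b"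
    using V\<^sub>1(2) V\<^sub>2(2) by eventually_elim (rule \<mu>)
  have fa: "f a \<in> P"
    using W(2) V\<^sub>1(2) V\<^sub>2(2) \<mu>[of a] eventually_nhds_x_imp_x unfolding P_def f_def by fastforce
  have f: "f differentiable (at a)"
  proof -
    obtain D\<^sub>1 D\<^sub>2 where "((\<lambda>b. x\<^sub>1 (f\<^sub>1 b)) has_derivative D\<^sub>1) (at a)"
        "((\<lambda>b. x\<^sub>2 (f\<^sub>2 b)) has_derivative D\<^sub>2) (at a)"
      using V\<^sub>1(3) V\<^sub>2(3) unfolding differentiable_def by blast
    from has_derivative_Pair[OF this] show ?thesis
      unfolding differentiable_def f_def by blast
  qed
  have evP: "\<forall>\<^sub>F b in nhds a. f b \<in> P"
  proof -
    have "isCont f a"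
      using f by (rule differentiable_imp_continuous_within)
    then have "filterlim f (nhds (f a)) (nhds a)"
      by (simp add: isCont_def tendsto_at_iff_tendsto_nhds)
    moreover have "\<forall>\<^sub>F p in nhds (f a). p \<in> P"
      using P(1) fa by (rule eventually_nhds_in_open)
    ultimately show ?thesis
      by (rule eventually_compose_filterlim[rotated])
  qed
  have "\<forall>\<^sub>F b in nhds a. f\<^sub>1 b \<otimes> f\<^sub>2 b \<in> W"
    using ev evP by eventually_elim (auto simp: P_def)
  moreover have "(\<lambda>b. y (f\<^sub>1 b \<otimes> f\<^sub>2 b)) differentiable (at a)"
  proof -
    obtain D\<^sub>f D\<^sub>y where "(f has_derivative D\<^sub>f) (at a)"
        "((\<lambda>p. y (\<mu> p)) has_derivative D\<^sub>y) (at (f a))"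
      using f smooth_on_imp_differentiable[OF P(2) fa] unfolding differentiable_def by blast
    then have "((\<lambda>b. y (\<mu> (f b))) has_derivative (\<lambda>b. D\<^sub>y (D\<^sub>f b))) (at a)"
      by (rule has_derivative_compose)
    moreover have "\<forall>\<^sub>F b in nhds a. y (\<mu> (f b)) = y (f\<^sub>1 b \<otimes> f\<^sub>2 b)"
      using ev by eventually_elim simp
    ultimately show ?thesis
      unfolding differentiable_def by (blast intro: has_derivative_transform_nhds)
  qed
  ultimately show ?thesis ..
qed

lemma chart_differentiable_mult:
  assumes "chart_differentiable f\<^sub>1 a" and "chart_differentiable f\<^sub>2 a"
  shows "chart_differentiable (\<lambda>b. f\<^sub>1 b \<otimes> f\<^sub>2 b) a"
proof -
  have "f\<^sub>1 a \<in> carrier G" "f\<^sub>2 a \<in> carrier G"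
    using assms chart_subset eventually_nhds_x_imp_x unfolding chart_differentiable_def by blast+
  then obtain W y where "(W, y) \<in> A" "f\<^sub>1 a \<otimes> f\<^sub>2 a \<in> W"
    using chart_around m_closed by metis
  with chart_differentiable_mult_in_chart[OF assms this] show ?thesis
    unfolding chart_differentiable_def by blast
qed

end

section \<open>The adjoint representation\<close>

context lie_group_action
begin

lemma param_carrier: "a \<in> N \<Longrightarrow> \<Gamma> a \<in> carrier G"
  using chart_subset[OF param_chart] by blast

lemma param_coordinate: "a \<in> N \<Longrightarrow> inv_into N \<Gamma> (\<Gamma> a) = a"
  using param_domain(3) by simp

lemma param_coordinate_range: "inv_into N \<Gamma> ` (\<Gamma> ` N) = N"
  using param_domain(3) by (simp add: inv_into_image_cancel)

lemma param_inverse_coordinate: "a \<in> N \<Longrightarrow> inv_into (\<Gamma> ` N) (inv_into N \<Gamma>) a = \<Gamma> a"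
  using chart_inverse[OF param_chart, of "\<Gamma> a"] param_coordinate by auto

lemma open_axis_param: "open {t. axis r t \<in> N}"
proof -
  have "isCont (axis r :: real \<Rightarrow> real ^ 'r) t" for t
    using axis_has_derivative has_derivative_continuous by blast
  then show ?thesis
    using continuous_open_vimage[OF param_domain(1)] by (auto simp: vimage_def)
qed

lemma eventually_axis_param: "\<forall>\<^sub>F t in nhds 0. axis r t \<in> N"
  using eventually_nhds_in_open[OF open_axis_param, of 0] param_domain(2) by (simp add: axis_0)

lemma action_one: "u \<in> U \<Longrightarrow> \<phi> \<one> u = u"
  using id_eq_one by (metis restrict_apply')

lemma action_closed: "g \<in> carrier G \<Longrightarrow> u \<in> U \<Longrightarrow> \<phi> g u \<in> U"
  using element_image by blast

lemma action_param_smooth: "smooth_on (N \<times> U) (\<lambda>(a, u). \<phi> (inv_into (\<Gamma> ` N) (inv_into N \<Gamma>) a) u)"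
  using action_smooth[OF param_chart] param_coordinate_range by simp

lemma action_differentiable:
  assumes "g \<in> carrier G" and "u \<in> U"
  shows "\<phi> g differentiable (at u)"
proof -
  obtain V x where V: "(V, x) \<in> A" "g \<in> V"
    using assms(1) by (rule chart_around)
  have "(\<lambda>(a, u). \<phi> (inv_into V x a) u) differentiable (at (x g, u))"
    using smooth_on_imp_differentiable[OF action_smooth[OF V(1)]] V(2) assms(2) by blast
  then obtain D where "((\<lambda>(a, u). \<phi> (inv_into V x a) u) has_derivative D) (at (x g, u))"
    unfolding differentiable_def by blast
  moreover have "((\<lambda>u. (x g, u)) has_derivative (\<lambda>v. (0, v))) (at u)"
    by (auto intro!: derivative_eq_intros)
  ultimately have "((\<lambda>u. \<phi> (inv_into V x (x g)) u) has_derivative (\<lambda>v. D (0, v))) (at u)"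
    using has_derivative_compose by fastforce
  then show ?thesis
    using chart_inverse[OF V] unfolding differentiable_def by auto
qed

lemma action_has_derivative:
  assumes "g \<in> carrier G" and "u \<in> U"
  shows "(\<phi> g has_derivative (\<lambda>v. matrix (frechet_derivative (\<phi> g) (at u)) *v v)) (at u)"
proof -
  have *: "(\<phi> g has_derivative frechet_derivative (\<phi> g) (at u)) (at u)"
    using action_differentiable[OF assms] frechet_derivative_works by blast
  then have "(\<lambda>v. matrix (frechet_derivative (\<phi> g) (at u)) *v v) = frechet_derivative (\<phi> g) (at u)"
    using matrix_works[OF has_derivative_linear[OF *, folded linear_matrix_vector_mul_eq]] by auto
  with * show ?thesis
    by simp
qed

text \<open>
  The columns of the matrix of characteristics are partial derivatives along the coordinate
  axes of the group parameters; since the action is smooth they assemble to a total derivative.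
\<close>

lemma param_action_has_derivative:
  assumes "u \<in> U"
  shows "((\<lambda>a. \<phi> (\<Gamma> a) u) has_derivative (\<lambda>b. characteristics \<phi> \<Gamma> u *v b)) (at 0)"
proof -
  obtain D\<^sub>0 where D\<^sub>0: "((\<lambda>(a, u). \<phi> (inv_into (\<Gamma> ` N) (inv_into N \<Gamma>) a) u) has_derivative D\<^sub>0) (at (0, u))"
    using smooth_on_imp_differentiable[OF action_param_smooth, of "(0, u)"] param_domain(2) assms
    unfolding differentiable_def by blast
  define D where "D b = D\<^sub>0 (b, 0)" for b
  have "((\<lambda>a. (a, u)) has_derivative (\<lambda>b. (b, 0))) (at 0)"
    by (auto intro!: derivative_eq_intros)
  with D\<^sub>0 have "((\<lambda>a. \<phi> (inv_into (\<Gamma> ` N) (inv_into N \<Gamma>) a) u) has_derivative D) (at 0)"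
    unfolding D_def using has_derivative_compose by fastforce
  moreover have "\<forall>\<^sub>F a in nhds 0. \<phi> (inv_into (\<Gamma> ` N) (inv_into N \<Gamma>) a) u = \<phi> (\<Gamma> a) u"
    using eventually_nhds_in_open[OF param_domain(1,2)]
    by eventually_elim (simp add: param_inverse_coordinate)
  ultimately have D: "((\<lambda>a. \<phi> (\<Gamma> a) u) has_derivative D) (at 0)"
    by (rule has_derivative_transform_nhds)
  have "D (axis r 1) = characteristics \<phi> \<Gamma> u *v axis r 1" for r
  proof -
    have "((\<lambda>a. \<phi> (\<Gamma> a) u) has_derivative D) (at (axis r 0))"
      using D by (simp add: axis_0)
    from has_derivative_compose[OF axis_has_derivative this]
    have "((\<lambda>t. \<phi> (\<Gamma> (axis r t)) u) has_derivative (\<lambda>t. D (axis r t))) (at 0)" .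
    from deriv_component[OF this] show ?thesis
      by (simp add: characteristics_def matrix_vector_mult_basis column_def vec_eq_iff)
  qed
  then have "D = (\<lambda>b. characteristics \<phi> \<Gamma> u *v b)"
    by (intro linear_eq_stdbasis has_derivative_linear[OF D] matrix_vector_mul_linear)
      (auto simp: Basis_vec_def)
  with D show ?thesis
    by simp
qed

text \<open>
  Conjugation by \<open>g\<close> carries the one-parameter curves of the coordinates to curves through the
  identity, whose velocities in the coordinates are the columns of the matrix wanted:
  both sides differentiate \<open>g \<cdot> \<Gamma>(a) \<cdot> u = (g \<Gamma>(a) g\<^sup>-\<^sup>1) \<cdot> (g \<cdot> u)\<close> along an axis.
\<close>

lemma adjoint_exists:
  assumes g: "g \<in> carrier G"
  shows "\<exists>B. \<forall>u\<in>U. matrix (frechet_derivative (\<phi> g) (at u)) ** characteristics \<phi> \<Gamma> u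
    = characteristics \<phi> \<Gamma> (\<phi> g u) ** B"
proof -
  define f where "f r t = g \<otimes> \<Gamma> (axis r t) \<otimes> inv g" for r t
  define c where "c r t = inv_into N \<Gamma> (f r t)" for r t
  have f0: "f r 0 = \<one>" for r
    using g by (simp add: f_def axis_0 param_0)
  have c: "(\<forall>\<^sub>F t in nhds 0. f r t \<in> \<Gamma> ` N) \<and> c r differentiable (at 0)" for r
  proof -
    have "(\<lambda>t. inv_into N \<Gamma> (\<Gamma> (axis r t))) differentiable (at 0)"
    proof -
      have "\<forall>\<^sub>F t in nhds 0. axis r t = inv_into N \<Gamma> (\<Gamma> (axis r t))"
        using eventually_axis_param[of r] by eventually_elim (simp add: param_coordinate)
      with axis_has_derivative show ?thesis
        unfolding differentiable_def by (blast intro: has_derivative_transform_nhds)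
    qed
    moreover have "\<forall>\<^sub>F t in nhds 0. \<Gamma> (axis r t) \<in> \<Gamma> ` N"
      using eventually_axis_param[of r] by eventually_elim blast
    ultimately have "chart_differentiable (\<lambda>t. \<Gamma> (axis r t)) 0"
      using param_chart unfolding chart_differentiable_def by blast
    then have "chart_differentiable (\<lambda>t. g \<otimes> \<Gamma> (axis r t)) 0"
      using g by (intro chart_differentiable_mult chart_differentiable_const)
    moreover have "chart_differentiable (\<lambda>_. inv g) (0::real)"
      using g by (intro chart_differentiable_const inv_closed)
    moreover have "g \<otimes> \<Gamma> (axis r 0) \<otimes> inv g \<in> \<Gamma> ` N"
      using f0[of r] param_0 param_domain(2) unfolding f_def by force
    ultimately show ?thesis
      unfolding f_def c_def by (intro chart_differentiable_mult_in_chart[OF _ _ param_chart])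
  qed
  define D where "D r = frechet_derivative (c r) (at 0)" for r
  have D: "(c r has_derivative D r) (at 0)" for r
    using c[of r] frechet_derivative_works unfolding D_def by blast
  have c0: "c r 0 = 0" for r
    using param_coordinate[OF param_domain(2)] param_0 f0 by (simp add: c_def)
  define B where "B = (\<chi> i r. D r 1 $ i)"
  have "matrix (frechet_derivative (\<phi> g) (at u)) ** characteristics \<phi> \<Gamma> u
      = characteristics \<phi> \<Gamma> (\<phi> g u) ** B" if u: "u \<in> U" for u
  proof -
    let ?F = "matrix (frechet_derivative (\<phi> g) (at u))"
    have "?F *v (characteristics \<phi> \<Gamma> u *v axis r 1) = characteristics \<phi> \<Gamma> (\<phi> g u) *v D r 1" for r
    proof -
      have "((\<lambda>a. \<phi> (\<Gamma> a) u) has_derivative (\<lambda>b. characteristics \<phi> \<Gamma> u *v b)) (at (axis r 0))"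
        using param_action_has_derivative[OF u] by (simp add: axis_0)
      \<comment> \<open>\<open>2\<close> differentiates \<open>g \<cdot> (\<Gamma>(a) \<cdot> u)\<close> along the axis, and \<open>3\<close> the action of the conjugated curve on \<open>g \<cdot> u\<close>.\<close>
      note 1 = has_derivative_compose[OF axis_has_derivative this]
      have "(\<phi> g has_derivative (\<lambda>v. ?F *v v)) (at (\<phi> (\<Gamma> (axis r 0)) u))"
        using action_has_derivative[OF g u] action_one[OF u] by (simp add: axis_0 param_0)
      note 2 = has_derivative_compose[OF 1 this]
      have "((\<lambda>a. \<phi> (\<Gamma> a) (\<phi> g u)) has_derivative (\<lambda>b. characteristics \<phi> \<Gamma> (\<phi> g u) *v b)) (at (c r 0))"
        using param_action_has_derivative[OF action_closed[OF g u]] c0 by simp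
      note 3 = has_derivative_compose[OF D this]
      have "\<forall>\<^sub>F t in nhds 0. f r t \<in> \<Gamma> ` N"
        using c by blast
      with eventually_axis_param[of r]
      have "\<forall>\<^sub>F t in nhds 0. \<phi> (\<Gamma> (c r t)) (\<phi> g u) = \<phi> g (\<phi> (\<Gamma> (axis r t)) u)"
      proof eventually_elim
        case (elim t)
        have \<Gamma>: "\<Gamma> (axis r t) \<in> carrier G"
          using elim(1) by (rule param_carrier)
        have "\<Gamma> (c r t) = f r t"
          using elim(2) by (simp add: c_def f_inv_into_f)
        then have "\<phi> (\<Gamma> (c r t)) (\<phi> g u) = \<phi> (f r t \<otimes> g) u"
          using composition_rule[OF u _ g] \<Gamma> g by (simp add: f_def)
        also have "f r t \<otimes> g = g \<otimes> \<Gamma> (axis r t)"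
          using \<Gamma> g by (simp add: f_def m_assoc)
        finally show ?case
          using composition_rule[OF u g \<Gamma>] by simp
      qed
      from has_derivative_unique[OF has_derivative_transform_nhds[OF 3 this] 2] show ?thesis
        by metis
    qed
    moreover have "B *v axis r 1 = D r 1" for r
      by (simp add: B_def matrix_vector_mult_basis column_def vec_eq_iff)
    ultimately have "(?F ** characteristics \<phi> \<Gamma> u) *v axis r 1
        = (characteristics \<phi> \<Gamma> (\<phi> g u) ** B) *v axis r 1" for r
      by (simp add: matrix_vector_mul_assoc[symmetric])
    then show ?thesis
      by (rule matrix_eq_axis)
  qed
  then show ?thesis
    by blast
qed

text \<open>
  A matrix is pinned down by its products with all \<open>\<Phi>(g \<cdot> u)\<close> because \<open>g \<cdot> u\<close> runs through all of \<open>U\<close>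
  and the generators are independent.
\<close>

lemma characteristics_left_cancel:
  assumes g: "g \<in> carrier G"
    and eq: "\<And>u. u \<in> U \<Longrightarrow>
      characteristics \<phi> \<Gamma> (\<phi> g u) ** B = characteristics \<phi> \<Gamma> (\<phi> g u) ** B'"
  shows "B = B'"
proof -
  have all: "characteristics \<phi> \<Gamma> w ** B = characteristics \<phi> \<Gamma> w ** B'" if "w \<in> U" for w
  proof -
    have "w \<in> \<phi> g ` U"
      using that surj_prop[OF g] by simp
    then obtain u where u: "u \<in> U" "w = \<phi> g u"
      by blast
    show ?thesis
      unfolding u(2) by (rule eq[OF u(1)])
  qed
  have 0: "(B - B') *v axis r 1 = 0" for r
  proof (rule generators_independent, rule ballI)
    fix w assume "w \<in> U"
    then have "(characteristics \<phi> \<Gamma> w ** B) *v axis r 1 = (characteristics \<phi> \<Gamma> w ** B') *v axis r 1"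
      using all by simp
    then show "characteristics \<phi> \<Gamma> w *v ((B - B') *v axis r 1) = 0"
      by (simp add: matrix_vector_mul_assoc[symmetric] matrix_vector_mult_diff_distrib
          matrix_vector_mult_diff_rdistrib)
  qed
  show ?thesis
    by (rule matrix_eq_axis) (use 0 in \<open>simp add: matrix_vector_mult_diff_rdistrib\<close>)
qed

lemma adjoint_rep_intertwines:
  assumes "g \<in> carrier G" and "u \<in> U"
  shows "matrix (frechet_derivative (\<phi> g) (at u)) ** characteristics \<phi> \<Gamma> u
    = characteristics \<phi> \<Gamma> (\<phi> g u) ** adjoint_rep \<phi> \<Gamma> U g"
proof -
  have "\<exists>!B. \<forall>u\<in>U. matrix (frechet_derivative (\<phi> g) (at u)) ** characteristics \<phi> \<Gamma> u
      = characteristics \<phi> \<Gamma> (\<phi> g u) ** B"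
    using adjoint_exists[OF assms(1)] by (auto intro: characteristics_left_cancel[OF assms(1)])
  from theI'[OF this] show ?thesis
    using assms(2) unfolding adjoint_rep_def by blast
qed

text \<open>The chain rule for \<open>u \<mapsto> g \<cdot> (k \<cdot> u)\<close>, with both factors moved past \<open>\<Phi>\<close> in turn.\<close>

lemma adjoint_rep_mult:
  assumes g: "g \<in> carrier G" and k: "k \<in> carrier G"
  shows "adjoint_rep \<phi> \<Gamma> U (g \<otimes> k) = adjoint_rep \<phi> \<Gamma> U g ** adjoint_rep \<phi> \<Gamma> U k"
proof (rule characteristics_left_cancel[of "g \<otimes> k"])
  show "g \<otimes> k \<in> carrier G"
    using g k by simp
  fix u assume u: "u \<in> U"
  let ?d = "\<lambda>g u. matrix (frechet_derivative (\<phi> g) (at u))"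
  have gk: "\<phi> (g \<otimes> k) w = \<phi> g (\<phi> k w)" if "w \<in> U" for w
    using composition_rule[OF that g k] .
  have "((\<lambda>w. \<phi> g (\<phi> k w)) has_derivative (\<lambda>v. ?d g (\<phi> k u) *v (?d k u *v v))) (at u)"
    by (rule has_derivative_compose[OF action_has_derivative[OF k u]
          action_has_derivative[OF g action_closed[OF k u]]])
  then have "(\<phi> (g \<otimes> k) has_derivative (\<lambda>v. ?d g (\<phi> k u) *v (?d k u *v v))) (at u)"
    by (rule has_derivative_transform_within_open[OF _ open_U u]) (simp add: gk)
  then have "(\<lambda>v. ?d (g \<otimes> k) u *v v) = (\<lambda>v. ?d g (\<phi> k u) *v (?d k u *v v))"
    using has_derivative_unique[OF action_has_derivative[OF _ u]] g k by simp
  then have chain: "?d (g \<otimes> k) u = ?d g (\<phi> k u) ** ?d k u"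
    by (simp add: matrix_eq matrix_vector_mul_assoc fun_eq_iff)
  have "characteristics \<phi> \<Gamma> (\<phi> (g \<otimes> k) u) ** adjoint_rep \<phi> \<Gamma> U (g \<otimes> k)
      = ?d g (\<phi> k u) ** (?d k u ** characteristics \<phi> \<Gamma> u)"
    using adjoint_rep_intertwines[OF _ u, of "g \<otimes> k"] g k chain by (simp add: matrix_mul_assoc)
  also have "\<dots> = (?d g (\<phi> k u) ** characteristics \<phi> \<Gamma> (\<phi> k u)) ** adjoint_rep \<phi> \<Gamma> U k"
    using adjoint_rep_intertwines[OF k u] by (simp add: matrix_mul_assoc)
  also have "\<dots> = characteristics \<phi> \<Gamma> (\<phi> (g \<otimes> k) u) ** (adjoint_rep \<phi> \<Gamma> U g ** adjoint_rep \<phi> \<Gamma> U k)"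
    using adjoint_rep_intertwines[OF g action_closed[OF k u]] gk[OF u] by (simp add: matrix_mul_assoc)
  finally show "characteristics \<phi> \<Gamma> (\<phi> (g \<otimes> k) u) ** adjoint_rep \<phi> \<Gamma> U (g \<otimes> k)
      = characteristics \<phi> \<Gamma> (\<phi> (g \<otimes> k) u) ** (adjoint_rep \<phi> \<Gamma> U g ** adjoint_rep \<phi> \<Gamma> U k)" .
qed

text \<open>
  With the frame held fixed, the derivative along the group path is the column \<open>r\<close> of \<open>\<Phi>(u\<^sub>0)\<close> pushed forward
  by \<open>\<rho>\<^sub>0\<close>; the adjoint representation rewrites it by the characteristics at \<open>\<rho>\<^sub>0 \<cdot> u\<^sub>0\<close>.
\<close>

lemma sigma_path_adjoint:
  assumes \<rho>: "\<rho> n z \<in> carrier G" and u: "z 0 \<in> U"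
  shows "sigma_path \<phi> \<Gamma> \<rho> r n z $ \<alpha>
    = (invariantized_row \<phi> \<Gamma> \<rho> \<alpha> n z v* adjoint_rep \<phi> \<Gamma> U (\<rho> n z)) $ r"
proof -
  let ?d = "matrix (frechet_derivative (\<phi> (\<rho> n z)) (at (z 0)))"
  have "((\<lambda>a. \<phi> (\<Gamma> a) (z 0)) has_derivative (\<lambda>b. characteristics \<phi> \<Gamma> (z 0) *v b)) (at (axis r 0))"
    using param_action_has_derivative[OF u] by (simp add: axis_0)
  note 1 = has_derivative_compose[OF axis_has_derivative this]
  have "(\<phi> (\<rho> n z) has_derivative (\<lambda>v. ?d *v v)) (at (\<phi> (\<Gamma> (axis r 0)) (z 0)))"
    using action_has_derivative[OF \<rho> u] action_one[OF u] by (simp add: axis_0 param_0)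
  from deriv_component[OF has_derivative_compose[OF 1 this]]
  have "sigma_path \<phi> \<Gamma> \<rho> r n z $ \<alpha> = (?d *v (characteristics \<phi> \<Gamma> (z 0) *v axis r 1)) $ \<alpha>"
    by (simp add: sigma_path_def)
  also have "\<dots> = (characteristics \<phi> \<Gamma> (\<phi> (\<rho> n z) (z 0)) ** adjoint_rep \<phi> \<Gamma> U (\<rho> n z)) $ \<alpha> $ r"
    unfolding matrix_vector_mul_assoc adjoint_rep_intertwines[OF \<rho> u]
    by (simp add: matrix_vector_mult_basis column_def)
  also have "\<dots> = (invariantized_row \<phi> \<Gamma> \<rho> \<alpha> n z v* adjoint_rep \<phi> \<Gamma> U (\<rho> n z)) $ r"
    by (simp add: invariantized_row_def matrix_matrix_mult_def vector_matrix_mult_def mult.commute)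
  finally show ?thesis .
qed

section \<open>Variations along group paths\<close>

text \<open>The time comes last, so that \<open>group_path r z\<close> is itself a variation, with \<open>z\<close> at \<open>t = 0\<close>.\<close>

definition group_path :: "'r \<Rightarrow> (int \<Rightarrow> real ^ 'q) \<Rightarrow> int \<Rightarrow> real \<Rightarrow> real ^ 'q" where
  "group_path r z j t = \<phi> (\<Gamma> (axis r t)) (z j)"

lemma group_path_smooth:
  assumes "z j \<in> U"
  shows "smooth_on {t. axis r t \<in> N} (group_path r z j)"
proof (rule smooth_on_cong[OF open_axis_param])
  have line: "(0, z j) + t *\<^sub>R (axis r 1, 0) = (axis r t, z j)" for t
    using axis_eq_scaleR[of r t] by simp
  have "(axis r 1 :: real ^ 'r, 0 :: real ^ 'q) \<in> Basis"
    by (simp add: Basis_prod_def axis_in_Basis_iff)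
  then show "smooth_on {t. axis r t \<in> N}
      (\<lambda>t. (\<lambda>(a, u). \<phi> (inv_into (\<Gamma> ` N) (inv_into N \<Gamma>) a) u) ((0, z j) + t *\<^sub>R (axis r 1, 0)))"
    by (rule smooth_on_line[OF open_axis_param _ _ action_param_smooth])
      (use line assms in auto)
  show "(\<lambda>(a, u). \<phi> (inv_into (\<Gamma> ` N) (inv_into N \<Gamma>) a) u) ((0, z j) + t *\<^sub>R (axis r 1, 0))
      = group_path r z j t" if "t \<in> {t. axis r t \<in> N}" for t
    unfolding line using that by (simp add: group_path_def param_inverse_coordinate)
qed

lemma group_path_at_0: "(\<And>j. z j \<in> U) \<Longrightarrow> (\<lambda>j. group_path r z j 0) = z"
  by (simp add: group_path_def axis_0 param_0 action_one)

lemma group_path_shift: "(\<lambda>j. group_path r z (j + k)) = group_path r (\<lambda>j. z (j + k))"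
  by (simp add: group_path_def fun_eq_iff)

lemma frame_sigma_group_path:
  assumes "\<And>j. z j \<in> U"
  shows "frame_sigma \<phi> \<rho> 0 n (group_path r z) = sigma_path \<phi> \<Gamma> \<rho> r n z"
  by (simp add: frame_sigma_def sigma_path_def at_time_def group_path_at_0[OF assms])
    (simp add: group_path_def)

end

lemma in_terms_of_at_time:
  "in_terms_of (at_time t \<kappa>) f n v = in_terms_of \<kappa> f n (\<lambda>j. v j t)"
  by (simp add: in_terms_of_def invariant_jet_def shift_def at_time_def)

lemma adjoint_op_at_time:
  "adjoint_op I h (at_time t \<kappa>) (in_terms_of (at_time t \<kappa>) e) n v
    = adjoint_op I h \<kappa> (in_terms_of \<kappa> e) n (\<lambda>j. v j t)"
  by (simp add: adjoint_op_def shift_def in_terms_of_at_time)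

section \<open>Shifts and group elements on the frame domain\<close>

lemma shift_0: "shift 0 F = F"
  by (simp add: shift_def fun_eq_iff)

context difference_moving_frame
begin

lemma frame_domain_window:
  assumes "z \<in> frame_domain J\<^sub>0 J M n"
  shows "(\<lambda>j\<in>{J\<^sub>0..J}. z (j + k)) \<in> M (n + k)"
  using assms unfolding frame_domain_def by simp

lemma frame_domain_shift:
  assumes "z \<in> frame_domain J\<^sub>0 J M n"
  shows "(\<lambda>j. z (j + k)) \<in> frame_domain J\<^sub>0 J M (n + k)"
  unfolding frame_domain_def
proof (clarify)
  fix l
  have "(\<lambda>j\<in>{J\<^sub>0..J}. z (j + (l + k))) \<in> M (n + (l + k))"
    using assms by (rule frame_domain_window)
  then show "(\<lambda>j\<in>{J\<^sub>0..J}. z (j + l + k)) \<in> M (n + k + l)"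
    by (simp add: add.commute add.left_commute)
qed

lemma frame_domain_in_U:
  assumes "z \<in> frame_domain J\<^sub>0 J M n"
  shows "z j \<in> U"
proof -
  have "(\<lambda>i\<in>{J\<^sub>0..J}. z (i + j)) \<in> M (n + j)"
    using assms by (rule frame_domain_window)
  also have "\<dots> \<subseteq> {J\<^sub>0..J} \<rightarrow>\<^sub>E U"
    using domain_open openin_imp_subset by blast
  finally have "(\<lambda>i\<in>{J\<^sub>0..J}. z (i + j)) 0 \<in> U"
    by (rule PiE_mem) (use window in simp)
  then show ?thesis
    using window by simp
qed

lemma restrict_prolonged:
  "(\<lambda>j\<in>I. prolonged UNIV \<phi> g z (j + k)) = prolonged I \<phi> g (\<lambda>j\<in>I. z (j + k))"
  by (auto simp: prolonged_def)

lemma frame_domain_invariant: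
  assumes "z \<in> frame_domain J\<^sub>0 J M n" and "g \<in> carrier G"
  shows "prolonged UNIV \<phi> g z \<in> frame_domain J\<^sub>0 J M n"
  unfolding frame_domain_def
  by (simp add: restrict_prolonged domain_invariant[OF frame_domain_window[OF assms(1)] assms(2)])

lemma shift_frame: "shift k \<rho> n z = \<rho> (n + k) (\<lambda>j\<in>{J\<^sub>0..J}. z (j + k))"
  unfolding shift_def by (rule frame_window[unfolded depends_on_def, rule_format])

lemma shift_frame_carrier:
  assumes "z \<in> frame_domain J\<^sub>0 J M n"
  shows "shift k \<rho> n z \<in> carrier G"
  unfolding shift_frame by (rule frame_carrier[OF frame_domain_window[OF assms]])

lemma shift_frame_equivariant:
  assumes "z \<in> frame_domain J\<^sub>0 J M n" and "g \<in> carrier G"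
  shows "shift k \<rho> n (prolonged UNIV \<phi> g z) = shift k \<rho> n z \<otimes> inv g"
  unfolding shift_frame restrict_prolonged
  by (rule frame_equivariant[OF frame_domain_window[OF assms(1)] assms(2)])

lemmas frame_domain_frame_carrier = shift_frame_carrier[where k = 0, unfolded shift_0]
  and frame_domain_frame_equivariant = shift_frame_equivariant[where k = 0, unfolded shift_0]

lemma shift_invariant:
  assumes "invariant_on G \<phi> (frame_domain J\<^sub>0 J M) F"
    and "z \<in> frame_domain J\<^sub>0 J M n" and "g \<in> carrier G"
  shows "shift k F n (prolonged UNIV \<phi> g z) = shift k F n z"
proof -
  have "(\<lambda>j. prolonged UNIV \<phi> g z (j + k)) = prolonged UNIV \<phi> g (\<lambda>j. z (j + k))"
    by (simp add: prolonged_def fun_eq_iff)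
  then show ?thesis
    using assms(1,3) frame_domain_shift[OF assms(2)] unfolding invariant_on_def shift_def by simp
qed

lemma in_terms_of_invariant:
  assumes "invariant_on G \<phi> (frame_domain J\<^sub>0 J M) \<kappa>"
    and "z \<in> frame_domain J\<^sub>0 J M n" and "g \<in> carrier G"
  shows "in_terms_of \<kappa> f n (prolonged UNIV \<phi> g z) = in_terms_of \<kappa> f n z"
  using shift_invariant[OF assms] by (simp add: in_terms_of_def invariant_jet_def)

section \<open>The Noether vector\<close>

text \<open>The factors \<open>g\<^sup>-\<^sup>1\<close> and \<open>g\<close> picked up by \<open>\<rho>\<^sub>0\<close> and \<open>u\<^sub>0\<close> cancel in \<open>\<rho>\<^sub>0 \<cdot> u\<^sub>0\<close>.\<close>

lemma invariantized_row_invariant: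
  "invariant_on G \<phi> (frame_domain J\<^sub>0 J M) (invariantized_row \<phi> \<Gamma> \<rho> \<alpha>)"
  unfolding invariant_on_def
proof (intro allI ballI)
  fix n z g
  assume z: "z \<in> frame_domain J\<^sub>0 J M n" and g: "g \<in> carrier G"
  have "\<phi> (\<rho> n (prolonged UNIV \<phi> g z)) (prolonged UNIV \<phi> g z 0) = \<phi> (\<rho> n z \<otimes> inv g) (\<phi> g (z 0))"
    using frame_domain_frame_equivariant[OF z g] by (simp add: prolonged_def)
  also have "\<dots> = \<phi> (\<rho> n z) (z 0)"
    using composition_rule[OF frame_domain_in_U[OF z, of 0], of "\<rho> n z \<otimes> inv g" g]
      frame_domain_frame_carrier[OF z] g by (simp add: m_assoc)
  finally show "invariantized_row \<phi> \<Gamma> \<rho> \<alpha> n (prolonged UNIV \<phi> g z) = invariantized_row \<phi> \<Gamma> \<rho> \<alpha> n z"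
    by (simp add: invariantized_row_def)
qed

text \<open>
  Apart from \<open>\<kappa>\<close> and the invariantized characteristics, only \<open>\<rho>\<^sub>j \<rho>\<^sub>0\<^sup>-\<^sup>1\<close> enters, where the factors \<open>g\<^sup>-\<^sup>1\<close> picked
  up by \<open>\<rho>\<^sub>j\<close> and \<open>\<rho>\<^sub>0\<close> cancel.
\<close>

lemma noether_vector_invariant:
  assumes \<kappa>: "invariant_on G \<phi> (frame_domain J\<^sub>0 J M) \<kappa>"
  shows "invariant_on G \<phi> (frame_domain J\<^sub>0 J M) (noether_vector G U \<phi> \<Gamma> \<rho> \<kappa> I C)"
  unfolding invariant_on_def
proof (intro allI ballI)
  fix n z g
  assume z: "z \<in> frame_domain J\<^sub>0 J M n" and g: "g \<in> carrier G"
  have "shift j \<rho> n (prolonged UNIV \<phi> g z) \<otimes> inv (\<rho> n (prolonged UNIV \<phi> g z))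
      = shift j \<rho> n z \<otimes> inv (\<rho> n z)" for j
    using shift_frame_carrier[OF z] frame_domain_frame_carrier[OF z] g
    by (simp add: shift_frame_equivariant[OF z g] frame_domain_frame_equivariant[OF z g]
        inv_mult_group m_assoc inv_solve_left')
  then show "noether_vector G U \<phi> \<Gamma> \<rho> \<kappa> I C n (prolonged UNIV \<phi> g z)
      = noether_vector G U \<phi> \<Gamma> \<rho> \<kappa> I C n z"
    by (simp add: noether_vector_def in_terms_of_invariant[OF \<kappa> z g]
        shift_invariant[OF invariantized_row_invariant z g])
qed

text \<open>
  Each \<open>S\<^sub>j(\<sigma>\<^sup>\<alpha>)\<close> carries a factor \<open>\<A>d(\<rho>\<^sub>j) = \<A>d(\<rho>\<^sub>j \<rho>\<^sub>0\<^sup>-\<^sup>1) \<A>d(\<rho>\<^sub>0)\<close>; the last factor does not depend on \<open>j\<close>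
  and comes out of the sum.
\<close>

lemma boundary_term_sigma_path:
  assumes z: "z \<in> frame_domain J\<^sub>0 J M n"
  shows "boundary_term I C \<kappa> (sigma_path \<phi> \<Gamma> \<rho> r) n z
    = (noether_vector G U \<phi> \<Gamma> \<rho> \<kappa> I C n z v* adjoint_rep \<phi> \<Gamma> U (\<rho> n z)) $ r"
proof -
  let ?Ad = "adjoint_rep \<phi> \<Gamma> U"
  have \<sigma>: "shift j (sigma_path \<phi> \<Gamma> \<rho> r) n z $ \<alpha>
      = (shift j (invariantized_row \<phi> \<Gamma> \<rho> \<alpha>) n z v* ?Ad (shift j \<rho> n z \<otimes> inv (\<rho> n z)) v* ?Ad (\<rho> n z)) $ r"
    for j \<alpha>
  proof -
    have "shift j (sigma_path \<phi> \<Gamma> \<rho> r) n z $ \<alpha>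
        = (shift j (invariantized_row \<phi> \<Gamma> \<rho> \<alpha>) n z v* ?Ad (shift j \<rho> n z)) $ r"
      using sigma_path_adjoint[of \<rho> "n + j" "\<lambda>i. z (i + j)"] shift_frame_carrier[OF z, of j]
        frame_domain_in_U[OF z] by (simp add: shift_def)
    also have "?Ad (shift j \<rho> n z) = ?Ad (shift j \<rho> n z \<otimes> inv (\<rho> n z)) ** ?Ad (\<rho> n z)"
      using adjoint_rep_mult[of "shift j \<rho> n z \<otimes> inv (\<rho> n z)" "\<rho> n z"]
        shift_frame_carrier[OF z, of j] frame_domain_frame_carrier[OF z] by (simp add: m_assoc)
    finally show ?thesis
      by (simp add: vector_matrix_mul_assoc)
  qed
  have linear: "linear (\<lambda>x. (x v* ?Ad (\<rho> n z)) $ r)"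
    by (intro linearI) (simp_all add: vector_matrix_mult_def distrib_left distrib_right sum.distrib
        sum_distrib_left mult_ac)
  show ?thesis
    unfolding noether_vector_def boundary_term_def \<sigma>
    by (simp add: linear_sum[OF linear] linear_cmul[OF linear])
qed

section \<open>Conservation along group paths\<close>

lemma group_path_prolonged: "(\<lambda>j. group_path r z j t) = prolonged UNIV \<phi> (\<Gamma> (axis r t)) z"
  by (simp add: group_path_def prolonged_def fun_eq_iff)

lemma group_path_variation:
  assumes z: "z \<in> frame_domain J\<^sub>0 J M n"
  shows "variation (frame_domain J\<^sub>0 J M n) 0 (group_path r z)"
  unfolding variation_def
proof (intro exI[of _ "{t. axis r t \<in> N}"] conjI allI ballI)
  show "0 \<in> {t. axis r t \<in> N}"
    using param_domain(2) by (simp add: axis_0)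
  show "smooth_on {t. axis r t \<in> N} (group_path r z j)" for j
    using frame_domain_in_U[OF z] by (rule group_path_smooth)
  show "(\<lambda>j. group_path r z j s) \<in> frame_domain J\<^sub>0 J M n" if "s \<in> {t. axis r t \<in> N}" for s
    unfolding group_path_prolonged using that by (intro frame_domain_invariant[OF z] param_carrier) simp
qed (rule open_axis_param)

text \<open>
  Invariants are constant along a group path, so the syzygies annihilate \<open>\<sigma>\<close> and the first term of the
  boundary identity drops out; the second one drops out on solutions.
\<close>

lemma boundary_term_conserved:
  fixes \<kappa> :: "int \<Rightarrow> (int \<Rightarrow> real ^ 'q) \<Rightarrow> real ^ 'k"
  assumes \<kappa>: "invariant_on G \<phi> (frame_domain J\<^sub>0 J M) \<kappa>"
    and z: "z \<in> frame_domain J\<^sub>0 J M n"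
    and syzygies: "((\<lambda>s. at_time s \<kappa> n (group_path r z)) has_vector_derivative
      diff_op I\<^sub>H h (at_time 0 \<kappa>) (frame_sigma \<phi> \<rho> 0) n (group_path r z)) (at 0)"
    and boundary: "in_terms_of (at_time 0 \<kappa>) e n (group_path r z) \<bullet>
          diff_op I\<^sub>H h (at_time 0 \<kappa>) (frame_sigma \<phi> \<rho> 0) n (group_path r z)
        - adjoint_op I\<^sub>H h (at_time 0 \<kappa>) (in_terms_of (at_time 0 \<kappa>) e) n (group_path r z) \<bullet>
          frame_sigma \<phi> \<rho> 0 n (group_path r z)
      = shift 1 (boundary_term I\<^sub>C C (at_time 0 \<kappa>) (frame_sigma \<phi> \<rho> 0)) n (group_path r z)
        - boundary_term I\<^sub>C C (at_time 0 \<kappa>) (frame_sigma \<phi> \<rho> 0) n (group_path r z)"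
    and solution: "adjoint_op I\<^sub>H h \<kappa> (in_terms_of \<kappa> e) n z = 0"
  shows "shift 1 (boundary_term I\<^sub>C C \<kappa> (sigma_path \<phi> \<Gamma> \<rho> r)) n z
    = boundary_term I\<^sub>C C \<kappa> (sigma_path \<phi> \<Gamma> \<rho> r) n z"
proof -
  let ?v = "group_path r z"
  have U: "z j \<in> U" for j
    using z by (rule frame_domain_in_U)
  \<comment> \<open>Each point of the group path is a group element applied to \<open>z\<close>, so \<open>\<kappa>\<close> does not change along it.\<close>
  have "((\<lambda>s. at_time s \<kappa> n ?v) has_vector_derivative 0) (at 0)"
  proof (rule has_vector_derivative_transform_within_open[OF has_vector_derivative_const open_axis_param])
    show "0 \<in> {t. axis r t \<in> N}"
      using param_domain(2) by (simp add: axis_0)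
    show "\<kappa> n z = at_time s \<kappa> n ?v" if "s \<in> {t. axis r t \<in> N}" for s
      using \<kappa> z that param_carrier unfolding invariant_on_def at_time_def group_path_prolonged by simp
  qed
  then have H: "diff_op I\<^sub>H h (at_time 0 \<kappa>) (frame_sigma \<phi> \<rho> 0) n ?v = 0"
    using syzygies by (metis vector_derivative_unique_at)
  have adj: "adjoint_op I\<^sub>H h (at_time 0 \<kappa>) (in_terms_of (at_time 0 \<kappa>) e) n ?v = 0"
    using solution by (simp add: adjoint_op_at_time group_path_at_0[OF U])
  \<comment> \<open>Needed for \<open>z\<close> and for its shift, which occurs in the shifted boundary term.\<close>
  have A: "boundary_term I\<^sub>C C (at_time 0 \<kappa>) (frame_sigma \<phi> \<rho> 0) m (group_path r w)
      = boundary_term I\<^sub>C C \<kappa> (sigma_path \<phi> \<Gamma> \<rho> r) m w" if w: "\<And>j. w j \<in> U" for m w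
  proof -
    have "shift j (frame_sigma \<phi> \<rho> 0) m (group_path r w) = shift j (sigma_path \<phi> \<Gamma> \<rho> r) m w" for j
      using frame_sigma_group_path[of "\<lambda>i. w (i + j)"] w by (simp add: shift_def group_path_shift)
    then show ?thesis
      by (simp add: boundary_term_def in_terms_of_at_time group_path_at_0[OF w])
  qed
  have "shift 1 (boundary_term I\<^sub>C C (at_time 0 \<kappa>) (frame_sigma \<phi> \<rho> 0)) n ?v
      = shift 1 (boundary_term I\<^sub>C C \<kappa> (sigma_path \<phi> \<Gamma> \<rho> r)) n z"
    using A[of "\<lambda>j. z (j + 1)" "n + 1"] U by (simp add: shift_def group_path_shift)
  with boundary A[OF U] show ?thesis
    by (simp add: H adj)
qed

end

theorem corollary7p2:
  fixes G :: "('g, 'm) monoid_scheme"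
    and T :: "'g topology"
    and A :: "('g set \<times> ('g \<Rightarrow> real ^ 'r)) set"
    and U :: "(real ^ 'q) set"
    and \<phi> :: "'g \<Rightarrow> real ^ 'q \<Rightarrow> real ^ 'q"
    and N :: "(real ^ 'r) set"
    and \<Gamma> :: "real ^ 'r \<Rightarrow> 'g"
    and J\<^sub>0 J J\<^sub>L J\<^sub>1 :: int
    and M K Z :: "int \<Rightarrow> (int \<Rightarrow> real ^ 'q) set"
    and \<rho> :: "int \<Rightarrow> (int \<Rightarrow> real ^ 'q) \<Rightarrow> 'g"
    and \<kappa> :: "int \<Rightarrow> (int \<Rightarrow> real ^ 'q) \<Rightarrow> real ^ 'k"
    and Z\<^sub>\<kappa> :: "int \<Rightarrow> (int \<Rightarrow> real ^ 'k) set"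
    and L\<^sub>u :: "int \<Rightarrow> (int \<Rightarrow> real ^ 'q) \<Rightarrow> real"
    and L :: "int \<Rightarrow> (int \<Rightarrow> real ^ 'k) \<Rightarrow> real"
    and I\<^sub>H I\<^sub>C :: "int set"
    and h :: "int \<Rightarrow> 'k \<Rightarrow> 'q \<Rightarrow> (int \<Rightarrow> real ^ 'k) \<Rightarrow> real"
    and C :: "int \<Rightarrow> 'q \<Rightarrow> int \<Rightarrow> (int \<Rightarrow> real ^ 'k) \<Rightarrow> real"
    and V :: "int \<Rightarrow> (int \<Rightarrow> real ^ 'q) \<Rightarrow> real ^ 'r"
  assumes frame: "difference_moving_frame G T A U \<phi> N \<Gamma> J\<^sub>0 J M K \<rho>"
    and Z: "Z = frame_domain J\<^sub>0 J M"
    and generating: "generating_invariants G \<phi> Z \<kappa>"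
    and Z_kappa: "Z\<^sub>\<kappa> = (\<lambda>n. invariant_jet \<kappa> n ` Z n)"
    and lagrangian: "0 \<le> J\<^sub>L" "difference_function {0..J\<^sub>L} Z L\<^sub>u" "invariant_on G \<phi> Z L\<^sub>u"
    and lagrangian_kappa: "0 \<le> J\<^sub>1" "difference_function {0..J\<^sub>1} Z\<^sub>\<kappa> L"
      "\<And>n z. z \<in> Z n \<Longrightarrow> L\<^sub>u n z = in_terms_of \<kappa> L n z"
    and operator: "finite I\<^sub>H"
      "\<And>j \<alpha> \<beta>. j \<in> I\<^sub>H \<Longrightarrow> \<exists>a b. difference_function {a..b} Z\<^sub>\<kappa> (\<lambda>_. h j \<beta> \<alpha>)"
    and syzygies: "\<And>n t v. variation (Z n) t v \<Longrightarrow>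
      ((\<lambda>s. at_time s \<kappa> n v) has_vector_derivative
         diff_op I\<^sub>H h (at_time t \<kappa>) (frame_sigma \<phi> \<rho> t) n v) (at t)"
    and boundary_coeffs: "finite I\<^sub>C"
      "\<And>j \<alpha>. j \<in> I\<^sub>C \<Longrightarrow> \<exists>a b. difference_function {a..b} Z\<^sub>\<kappa> (C j \<alpha>)"
    and boundary: "\<And>n t v. variation (Z n) t v \<Longrightarrow>
      in_terms_of (at_time t \<kappa>) (euler J\<^sub>1 L) n v \<bullet>
          diff_op I\<^sub>H h (at_time t \<kappa>) (frame_sigma \<phi> \<rho> t) n v
        - adjoint_op I\<^sub>H h (at_time t \<kappa>) (in_terms_of (at_time t \<kappa>) (euler J\<^sub>1 L)) n v \<bullet>
          frame_sigma \<phi> \<rho> t n v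
      = shift 1 (boundary_term I\<^sub>C C (at_time t \<kappa>) (frame_sigma \<phi> \<rho> t)) n v
        - boundary_term I\<^sub>C C (at_time t \<kappa>) (frame_sigma \<phi> \<rho> t) n v"
    and V: "V = noether_vector G U \<phi> \<Gamma> \<rho> \<kappa> I\<^sub>C C"
  shows "invariant_on G \<phi> Z V \<and>
    (\<forall>n. \<forall>z\<in>Z n. \<forall>r. boundary_term I\<^sub>C C \<kappa> (sigma_path \<phi> \<Gamma> \<rho> r) n z
        = (V n z v* adjoint_rep \<phi> \<Gamma> U (\<rho> n z)) $ r) \<and>
    (\<forall>u. solution Z (adjoint_op I\<^sub>H h \<kappa> (in_terms_of \<kappa> (euler J\<^sub>1 L))) u \<longrightarrow>
      (\<forall>n. shift 1 (\<lambda>n z. V n z v* adjoint_rep \<phi> \<Gamma> U (\<rho> n z)) n (jet u n)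
        - V n (jet u n) v* adjoint_rep \<phi> \<Gamma> U (\<rho> n (jet u n)) = 0))"
proof -
  interpret difference_moving_frame G T A U \<phi> N \<Gamma> J\<^sub>0 J M K \<rho>
    by (rule frame)
  have \<kappa>: "invariant_on G \<phi> (frame_domain J\<^sub>0 J M) \<kappa>"
    using generating unfolding Z generating_invariants_def difference_invariant_def by blast
  let ?W = "\<lambda>n z. V n z v* adjoint_rep \<phi> \<Gamma> U (\<rho> n z)"
  have law: "boundary_term I\<^sub>C C \<kappa> (sigma_path \<phi> \<Gamma> \<rho> r) n z = ?W n z $ r" if "z \<in> Z n" for n z r
    using boundary_term_sigma_path that unfolding Z V by blast
  have "shift 1 ?W n (jet u n) - ?W n (jet u n) = 0"
    if sol: "solution Z (adjoint_op I\<^sub>H h \<kappa> (in_terms_of \<kappa> (euler J\<^sub>1 L))) u" for u n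
  proof -
    let ?z = "jet u n"
    have z: "?z \<in> Z n" "adjoint_op I\<^sub>H h \<kappa> (in_terms_of \<kappa> (euler J\<^sub>1 L)) n ?z = 0"
      using sol unfolding solution_def by blast+
    have "shift 1 ?W n ?z $ r = ?W n ?z $ r" for r
    proof -
      have "shift 1 ?W n ?z $ r = shift 1 (boundary_term I\<^sub>C C \<kappa> (sigma_path \<phi> \<Gamma> \<rho> r)) n ?z"
        using law frame_domain_shift[of ?z n 1] z(1) unfolding Z shift_def by metis
      also have "\<dots> = boundary_term I\<^sub>C C \<kappa> (sigma_path \<phi> \<Gamma> \<rho> r) n ?z"
        using z(1) group_path_variation[of ?z n r] unfolding Z
        by (intro boundary_term_conserved[OF \<kappa> _ syzygies boundary z(2)]) (simp_all add: Z)
      also have "\<dots> = ?W n ?z $ r"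
        using z(1) by (rule law)
      finally show ?thesis .
    qed
    then show ?thesis
      by (simp add: vec_eq_iff)
  qed
  then show ?thesis
    using noether_vector_invariant[OF \<kappa>] law unfolding Z V by blast
qed

end
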